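(* Let $\mathfrak{m},\mathfrak{n}\in A_+$, let $\psi\in\widehat{(A/\mathfrak{m}A)^\times}$, let $k,m\ge 0$ be integers and let $f\in M_k^m(\mathfrak{m},\psi)$. Let $\chi\in\widehat{(A/\mathfrak{n}A)^\times}$ and let $\mathfrak{q}\in A_+$ be irreducible with $\gcd(\mathfrak{q},\mathfrak{n}\mathfrak{m})=1$. Put $\mathfrak{a}=\operatorname{lcm}(\mathfrak{m},\mathfrak{n}^2)$, so that $\hat\varpi_\chi f\in M_k^{m+s_\chi}(\Gamma_1(\mathfrak{a}))$. If $T_\mathfrak{q} f=\lambda_\mathfrak{q} f$ for some $\lambda_\mathfrak{q}\in\mathbb{C}_\infty$ (with $T_\mathfrak{q}$ the Hecke operator of weight $k$, type $m$, level $\mathfrak{m}$), then \[T_\mathfrak{q}\,\hat\varpi_\chi f=\chi(\mathfrak{q})\,\lambda_\mathfrak{q}\,\hat\varpi_\chi f,\] where on the left $T_\mathfrak{q}$ is the Hecke operator of weight $k$, type $m+s_\chi$ and level $\mathfrak{a}$.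
   Context: Let $\mathbb{F}_q$ be a finite field with $q$ elements, $A=\mathbb{F}_q[\theta]$, $K=\mathbb{F}_q(\theta)$, $K_\infty=\mathbb{F}_q((1/\theta))$ with absolute value normalized by $|\theta|=q$, and $\mathbb{C}_\infty$ the completion of an algebraic closure of $K_\infty$. $A_+$ is the set of monic polynomials; for $b\in A$, $|b|=q^{\deg b}$, so "$|\beta|<|\mathfrak{n}|$" means $\beta$ runs over all polynomials (including $0$) of degree $<\deg\mathfrak{n}$. $\Omega=\mathbb{C}_\infty\setminus K_\infty$ with its rigid analytic structure, $|z|_{\Im}=\inf_{\kappa\in K_\infty}|z-\kappa|$, and $\mathrm{GL}_2(K_\infty)$ acts on $\Omega$ by Möbius transformations. For $f:\Omega\to\mathbb{C}_\infty$, integers $k,m\ge0$ and $\gamma=\begin{pmatrix}a&b\\c&d\end{pmatrix}\in\mathrm{GL}_2(K)$, $f|_k^m[\gamma](z)=(\det\gamma)^m(cz+d)^{-k}f(\gamma z)$. $\Gamma(1)=\mathrm{GL}_2(A)$; for $\mathfrak{m}\in A_+$, $\Gamma(\mathfrak{m})$ is the kernel of reduction mod $\mathfrak{m}$, $\Gamma_0(\mathfrak{m})=\{\gamma\in\Gamma(1): c\in\mathfrak{m}A\}$, $\Gamma_1(\mathfrak{m})=\{\gamma\in\Gamma_0(\mathfrak{m}): d\equiv1\bmod \mathfrak{m}\}$. For $\Gamma\subset\Gamma(1)$ containing some $\Gamma(\mathfrak{m})$, $M_k^m(\Gamma)$ is the space of rigid analytic $f:\Omega\to\mathbb{C}_\infty$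 with $f|_k^m[\gamma]=f$ for all $\gamma\in\Gamma$ and $f|_k^m[\gamma]$ bounded on $\{|z|_{\Im}\ge1\}$ for all $\gamma\in\Gamma(1)$. Characters: for a monic square-free $\mathfrak{n}=\mathfrak{p}_1\cdots\mathfrak{p}_r$ (distinct monic irreducibles) fix roots $\zeta_i\in\mathbb{C}_\infty$ of $\mathfrak{p}_i$; for a root $\zeta$, $\chi_\zeta:A\to\mathbb{C}_\infty$ is the $\mathbb{F}_q$-algebra map $\theta\mapsto\zeta$. $\widehat{(A/\mathfrak{n}A)^\times}$ is the set of maps $\chi=\prod_i\chi_{\zeta_i}^{e_i}$, i.e. $\chi(a)=\prod_i a(\zeta_i)^{e_i}$, with $0\le e_i<|\mathfrak{p}_i|-1$ (convention $0^0=1$); for general monic $\mathfrak{m}$, $\widehat{(A/\mathfrak{m}A)^\times}$ means the characters modulo the radical of $\mathfrak{m}$. $\chi^{-1}$ is the character with exponents the residues of $-e_i$ in $\{0,\dots,|\mathfrak{p}_i|-2\}$. The sign $s_\chi\in\{0,\dots,q-2\}$ is the residue of $e_1+\dots+e_r$ mod $q-1$. For a function $\phi$ on $A$, $M_k^m(\mathfrak{m},\phi)=\{f\in M_k^m(\Gamma_1(\mathfrak{m})): f|_k^m[\gamma]=\phi(d)f \text{ for all }\gamma=\begin{pmatrix}a&b\\c&d\end{pmatrix}\in\Gamma_0(\mathfrak{m})\}$. Projection: for $\chi\in\widehat{(A/\mathfrak{n}A)^\times}$ and $f$ of weight $k$, type $m$: $\hat\varpi_\chi f=\sum_{|\beta|<|\mathfrak{n}|}\chi^{-1}(\beta)\,f|_k^m\!\left[\begin{pmatrix}\mathfrak{n}&\beta\\0&\mathfrak{n}\end{pmatrix}\right]$.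 Hecke operators: for $f\in M_k^m(\Gamma_1(\mathfrak{m}))$ and monic irreducible $\mathfrak{q}\nmid\mathfrak{m}$, $T_\mathfrak{q} f=\mathfrak{q}^{k-m}\Big(\sum_{|\beta|<|\mathfrak{q}|}f|_k^m\big[\begin{pmatrix}1&\beta\\0&\mathfrak{q}\end{pmatrix}\big]+f|_k^m\big[\begin{pmatrix}\mu\mathfrak{q}&\nu\\\mathfrak{m}\mathfrak{q}&\mathfrak{q}\end{pmatrix}\big]\Big)$ with $\mu,\nu\in A$, $\mu\mathfrak{q}-\nu\mathfrak{m}=1$. *)

theory Defs
  imports
    "HOL-Analysis.Analysis"
    "HOL-Computational_Algebra.Computational_Algebra"
    "HOL-Algebra.Algebraic_Closure_Type"
begin

unbundle no fps_syntax

text \<open>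
  The field \<open>\<F>\<^sub>q\<close> is a type \<open>'q\<close> of sort \<open>{finite_field, field_gcd}\<close>, so that \<open>q = CARD('q)\<close>.
  (On a field, all operations added by \<open>field_gcd\<close> that matter below are determined by the field
  structure; the class is only needed to have \<open>lcm\<close> and \<open>prime_factors\<close> on polynomials, both
  normalised to be monic.)
  The ring \<open>A = \<F>\<^sub>q[\<theta>]\<close> is \<open>'q poly\<close>, and \<open>K\<^sub>\<infinity> = \<F>\<^sub>q((1/\<theta>))\<close> is \<open>'q fls\<close>, the variable
  of the Laurent series being \<open>1/\<theta>\<close>, i.e. \<open>\<theta>\<close> is \<open>fls_X_inv\<close>.
\<close>

definition absA :: "'q::{finite_field,field_gcd} poly \<Rightarrow> nat" where
  "absA b = (if b = 0 then 0 else CARD('q) ^ Polynomial.degree b)"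

definition absK :: "'q::{finite_field,field_gcd} fls \<Rightarrow> real" where
  "absK x = (if x = 0 then 0 else real CARD('q) powi (- fls_subdegree x))"

definition of_A :: "'q::{finite_field,field_gcd} poly \<Rightarrow> 'q fls" where
  "of_A a = poly (map_poly fls_const a) fls_X_inv"

text \<open>
  The completion of an algebraic closure of \<open>K\<^sub>\<infinity>\<close>: a field \<open>'c\<close> whose metric comes from a
  non-archimedean absolute value \<open>\<bar>x\<bar> = dist x 0\<close>, which is complete (by its sort), together with a
  field embedding \<open>\<iota>\<close> of the algebraic closure of \<open>K\<^sub>\<infinity>\<close> that has dense image and is compatible with
  the absolute value of \<open>K\<^sub>\<infinity>\<close>. This determines \<open>'c\<close> and \<open>\<iota>\<close> up to isometric isomorphism.
\<close>

locale C_infinity =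
  fixes \<iota> :: "'q::{finite_field,field_gcd} fls alg_closure \<Rightarrow> 'c::{field,complete_space}"
  assumes dist_eq: "\<And>x y :: 'c. dist x y = dist (x - y) 0"
    and abs_mult: "\<And>x y :: 'c. dist (x * y) 0 = dist x 0 * dist y 0"
    and abs_ultrametric: "\<And>x y :: 'c. dist (x + y) 0 \<le> max (dist x 0) (dist y 0)"
    and emb_add: "\<And>x y. \<iota> (x + y) = \<iota> x + \<iota> y"
    and emb_mult: "\<And>x y. \<iota> (x * y) = \<iota> x * \<iota> y"
    and emb_one: "\<iota> 1 = 1"
    and emb_abs: "\<And>x. dist (\<iota> (to_ac x)) 0 = absK x"
    and emb_dense: "closure (range \<iota>) = UNIV"

type_synonym ('q, 'c) emb = "'q fls alg_closure \<Rightarrow> 'c"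

definition K_to_C :: "('q::{finite_field,field_gcd}, 'c::{field,complete_space}) emb \<Rightarrow> 'q fls \<Rightarrow> 'c" where
  "K_to_C \<iota> x = \<iota> (to_ac x)"

definition A_to_C :: "('q::{finite_field,field_gcd}, 'c::{field,complete_space}) emb \<Rightarrow> 'q poly \<Rightarrow> 'c" where
  "A_to_C \<iota> a = K_to_C \<iota> (of_A a)"

text \<open>The value \<open>a(\<zeta>) = \<chi>\<^sub>\<zeta>(a)\<close>.\<close>

definition evalA :: "('q::{finite_field,field_gcd}, 'c::{field,complete_space}) emb \<Rightarrow> 'q poly \<Rightarrow> 'c \<Rightarrow> 'c" where
  "evalA \<iota> a \<zeta> = poly (map_poly (\<lambda>c. K_to_C \<iota> (fls_const c)) a) \<zeta>"


section \<open>The Drinfeld upper half plane\<close>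

definition Omega :: "('q::{finite_field,field_gcd}, 'c::{field,complete_space}) emb \<Rightarrow> 'c set" where
  "Omega \<iota> = UNIV - range (K_to_C \<iota>)"

definition im_abs :: "('q::{finite_field,field_gcd}, 'c::{field,complete_space}) emb \<Rightarrow> 'c \<Rightarrow> real" where
  "im_abs \<iota> z = infdist z (range (K_to_C \<iota>))"

text \<open>
  The affinoids \<open>\<Omega>\<^sub>n\<close> form an admissible covering of \<open>\<Omega>\<close> which defines its rigid analytic structure.
  The analytic functions on \<open>\<Omega>\<^sub>n\<close> are the uniform limits of rational functions without poles
  on \<open>\<Omega>\<^sub>n\<close>. Functions on \<open>\<Omega>\<close> are modelled by total functions whose values outside \<open>\<Omega>\<close> are irrelevant.
\<close>

definition Omega_aff :: "('q::{finite_field,field_gcd}, 'c::{field,complete_space}) emb \<Rightarrow> nat \<Rightarrow> 'c set" where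
  "Omega_aff \<iota> n = {z. dist z 0 \<le> real CARD('q) ^ n \<and> im_abs \<iota> z \<ge> 1 / real CARD('q) ^ n}"

definition rigid_analytic ::
  "('q::{finite_field,field_gcd}, 'c::{field,complete_space}) emb \<Rightarrow> ('c \<Rightarrow> 'c) \<Rightarrow> bool" where
  "rigid_analytic \<iota> f \<longleftrightarrow>
     (\<forall>n. \<exists>P Q :: nat \<Rightarrow> 'c poly.
        (\<forall>i. \<forall>z\<in>Omega_aff \<iota> n. poly (Q i) z \<noteq> 0) \<and>
        uniform_limit (Omega_aff \<iota> n) (\<lambda>i z. poly (P i) z / poly (Q i) z) f sequentially)"


section \<open>Slash operators and modular forms\<close>

definition mat2 :: "'a \<Rightarrow> 'a \<Rightarrow> 'a \<Rightarrow> 'a \<Rightarrow> 'a::zero ^ 2 ^ 2" where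
  "mat2 a b c d = vector [vector [a, b], vector [c, d]]"

text \<open>The slash operator is defined for matrices over \<open>K\<^sub>\<infinity>\<close>, which contains \<open>K = \<F>\<^sub>q(\<theta>)\<close>; it is
  only meant for invertible ones.\<close>

definition slash ::
  "('q::{finite_field,field_gcd}, 'c::{field,complete_space}) emb \<Rightarrow> nat \<Rightarrow> nat \<Rightarrow> ('c \<Rightarrow> 'c) \<Rightarrow>
    'q fls ^ 2 ^ 2 \<Rightarrow> 'c \<Rightarrow> 'c" where
  "slash \<iota> k m f \<gamma> z =
     (let a = K_to_C \<iota> (\<gamma> $ 1 $ 1); b = K_to_C \<iota> (\<gamma> $ 1 $ 2);
          c = K_to_C \<iota> (\<gamma> $ 2 $ 1); d = K_to_C \<iota> (\<gamma> $ 2 $ 2)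
      in K_to_C \<iota> (det \<gamma>) ^ m * inverse ((c * z + d) ^ k) * f ((a * z + b) / (c * z + d)))"

definition slashA ::
  "('q::{finite_field,field_gcd}, 'c::{field,complete_space}) emb \<Rightarrow> nat \<Rightarrow> nat \<Rightarrow> ('c \<Rightarrow> 'c) \<Rightarrow>
    'q poly ^ 2 ^ 2 \<Rightarrow> 'c \<Rightarrow> 'c" where
  "slashA \<iota> k m f \<gamma> = slash \<iota> k m f (map_matrix of_A \<gamma>)"

definition Gamma_full :: "('q::{finite_field,field_gcd} poly ^ 2 ^ 2) set" where
  "Gamma_full = {\<gamma>. invertible \<gamma>}"

definition Gamma0 :: "'q::{finite_field,field_gcd} poly \<Rightarrow> ('q poly ^ 2 ^ 2) set" where
  "Gamma0 \<mm> = {\<gamma> \<in> Gamma_full. \<mm> dvd \<gamma> $ 2 $ 1}"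

definition Gamma1 :: "'q::{finite_field,field_gcd} poly \<Rightarrow> ('q poly ^ 2 ^ 2) set" where
  "Gamma1 \<mm> = {\<gamma> \<in> Gamma0 \<mm>. \<mm> dvd \<gamma> $ 2 $ 2 - 1}"

definition mod_forms ::
  "('q::{finite_field,field_gcd}, 'c::{field,complete_space}) emb \<Rightarrow> nat \<Rightarrow> nat \<Rightarrow>
    ('q poly ^ 2 ^ 2) set \<Rightarrow> ('c \<Rightarrow> 'c) set" where
  "mod_forms \<iota> k m \<Gamma> =
     {f. rigid_analytic \<iota> f \<and>
         (\<forall>\<gamma>\<in>\<Gamma>. \<forall>z\<in>Omega \<iota>. slashA \<iota> k m f \<gamma> z = f z) \<and>
         (\<forall>\<gamma>\<in>Gamma_full. bounded (slashA \<iota> k m f \<gamma> ` {z \<in> Omega \<iota>. im_abs \<iota> z \<ge> 1}))}"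

definition mod_forms_char ::
  "('q::{finite_field,field_gcd}, 'c::{field,complete_space}) emb \<Rightarrow> nat \<Rightarrow> nat \<Rightarrow>
    'q poly \<Rightarrow> ('q poly \<Rightarrow> 'c) \<Rightarrow> ('c \<Rightarrow> 'c) set" where
  "mod_forms_char \<iota> k m \<mm> \<phi> =
     {f \<in> mod_forms \<iota> k m (Gamma1 \<mm>).
        \<forall>\<gamma>\<in>Gamma0 \<mm>. \<forall>z\<in>Omega \<iota>. slashA \<iota> k m f \<gamma> z = \<phi> (\<gamma> $ 2 $ 2) * f z}"


section \<open>Characters\<close>

text \<open>
  A character modulo (the radical of) \<open>\<nn>\<close> is given by its exponents \<open>e p\<close> at the monic
  irreducible factors \<open>p\<close> of \<open>\<nn>\<close>, relative to chosen roots \<open>\<zeta> p\<close>.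
\<close>

definition root_choice ::
  "('q::{finite_field,field_gcd}, 'c::{field,complete_space}) emb \<Rightarrow> 'q poly \<Rightarrow> ('q poly \<Rightarrow> 'c) \<Rightarrow> bool" where
  "root_choice \<iota> \<nn> \<zeta> \<longleftrightarrow> (\<forall>p\<in>prime_factors \<nn>. evalA \<iota> p (\<zeta> p) = 0)"

definition char_exps :: "'q::{finite_field,field_gcd} poly \<Rightarrow> ('q poly \<Rightarrow> nat) set" where
  "char_exps \<nn> = {e. \<forall>p\<in>prime_factors \<nn>. e p < absA p - 1}"

definition char_of_exps ::
  "('q::{finite_field,field_gcd}, 'c::{field,complete_space}) emb \<Rightarrow> 'q poly \<Rightarrow> ('q poly \<Rightarrow> 'c) \<Rightarrow>
    ('q poly \<Rightarrow> nat) \<Rightarrow> 'q poly \<Rightarrow> 'c" where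
  "char_of_exps \<iota> \<nn> \<zeta> e a = (\<Prod>p\<in>prime_factors \<nn>. evalA \<iota> a (\<zeta> p) ^ e p)"

definition characters ::
  "('q::{finite_field,field_gcd}, 'c::{field,complete_space}) emb \<Rightarrow> 'q poly \<Rightarrow> ('q poly \<Rightarrow> 'c) \<Rightarrow>
    ('q poly \<Rightarrow> 'c) set" where
  "characters \<iota> \<nn> \<zeta> = char_of_exps \<iota> \<nn> \<zeta> ` char_exps \<nn>"

definition inv_exps :: "('q::{finite_field,field_gcd} poly \<Rightarrow> nat) \<Rightarrow> 'q poly \<Rightarrow> nat" where
  "inv_exps e p = nat (- int (e p) mod int (absA p - 1))"

definition char_sign :: "'q::{finite_field,field_gcd} poly \<Rightarrow> ('q poly \<Rightarrow> nat) \<Rightarrow> nat" where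
  "char_sign \<nn> e = (\<Sum>p\<in>prime_factors \<nn>. e p) mod (CARD('q) - 1)"


section \<open>Projections and Hecke operators\<close>

definition char_proj ::
  "('q::{finite_field,field_gcd}, 'c::{field,complete_space}) emb \<Rightarrow> nat \<Rightarrow> nat \<Rightarrow> 'q poly \<Rightarrow>
    ('q poly \<Rightarrow> 'c) \<Rightarrow> ('q poly \<Rightarrow> nat) \<Rightarrow> ('c \<Rightarrow> 'c) \<Rightarrow> 'c \<Rightarrow> 'c" where
  "char_proj \<iota> k m \<nn> \<zeta> e f z =
     (\<Sum>\<beta> | absA \<beta> < absA \<nn>.
        char_of_exps \<iota> \<nn> \<zeta> (inv_exps e) \<beta> * slashA \<iota> k m f (mat2 \<nn> \<beta> 0 \<nn>) z)"

text \<open>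
  The Hecke operator at \<open>\<qq>\<close> of weight \<open>k\<close>, type \<open>m\<close> and level \<open>\<mm>\<close>, formed with auxiliary
  \<open>\<mu>, \<nu>\<close> such that \<open>\<mu> \<qq> - \<nu> \<mm> = 1\<close>.
\<close>

definition hecke ::
  "('q::{finite_field,field_gcd}, 'c::{field,complete_space}) emb \<Rightarrow> nat \<Rightarrow> nat \<Rightarrow> 'q poly \<Rightarrow> 'q poly \<Rightarrow>
    'q poly \<Rightarrow> 'q poly \<Rightarrow> ('c \<Rightarrow> 'c) \<Rightarrow> 'c \<Rightarrow> 'c" where
  "hecke \<iota> k m \<mm> \<qq> \<mu> \<nu> f z =
     A_to_C \<iota> \<qq> powi (int k - int m) *
       ((\<Sum>\<beta> | absA \<beta> < absA \<qq>. slashA \<iota> k m f (mat2 1 \<beta> 0 \<qq>) z) +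
        slashA \<iota> k m f (mat2 (\<mu> * \<qq>) \<nu> (\<mm> * \<qq>) \<qq>) z)"

end

theory Submission
  imports Defs
begin

text \<open>
  Write \<open>[\<beta>]\<close> for the matrix with rows \<open>(\<nn>, \<beta>)\<close> and \<open>(0, \<nn>)\<close>. If \<open>\<sigma> \<in> \<Gamma>\<^sub>0(lcm(\<mm>, \<nn>\<^sup>2))\<close> has diagonal
  \<open>A, D\<close> and \<open>\<beta> D \<equiv> \<beta>' A\<close> modulo \<open>\<nn>\<close>, then \<open>[\<beta>] \<sigma> = \<gamma> [\<beta>']\<close> with \<open>\<gamma> \<in> \<Gamma>\<^sub>0(\<mm>)\<close> whose lower right
  entry is \<open>\<equiv> D\<close> modulo the radical of \<open>\<mm>\<close>. Hence slashing with \<open>\<sigma>\<close> permutes the summands of the projection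
  up to the factor \<open>\<psi>(D)\<close>; for \<open>\<sigma> \<in> \<Gamma>\<^sub>1\<close> the permutation is multiplication by \<open>det(\<sigma>)\<^sup>-\<^sup>1\<close>, which
  accounts for the change of type. Moving the Hecke matrices past \<open>[\<beta>]\<close> replaces \<open>\<beta>\<close> by \<open>\<qq> \<beta>\<close>, and
  reindexing the sum produces \<open>\<chi>(\<qq>)\<close>.

  For the behaviour at the cusps, \<open>[\<beta>] \<gamma> = \<gamma>' \<tau>\<close> with \<open>\<gamma>' \<in> GL\<^sub>2(A)\<close> and \<open>\<tau>\<close> upper triangular. As \<open>\<tau>\<close>
  may shrink the imaginary part, \<open>f|\<gamma>'\<close> must be bounded on \<open>{|z|\<^sub>I \<ge> \<epsilon>}\<close> for every \<open>\<epsilon> > 0\<close>: by periodicity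
  one may assume that \<open>z\<close> is bounded when \<open>|z|\<^sub>I < 1\<close>, and analytic functions are bounded on the affinoids
  \<open>\<Omega>\<^sub>n\<close>. The latter holds because the completion of the algebraic closure is algebraically closed, so that
  a polynomial without zeros on \<open>\<Omega>\<^sub>n\<close> is bounded away from zero there.
\<close>

section \<open>The absolute value\<close>

lemma poly_map_poly_add:
  assumes "h 0 = 0" "\<And>x y. h (x + y) = h x + h y"
  shows "poly (map_poly h (p + q)) x = poly (map_poly h p) x + (poly (map_poly h q) x :: 'b::comm_ring_1)"
proof -
  have "map_poly h (p + q) = map_poly h p + map_poly h q"
    by (intro poly_eqI) (simp add: coeff_map_poly assms)
  then show ?thesis by simp
qed

text \<open>Stated for a bare ring map \<open>h\<close> because it serves three of them:
  \<open>\<iota>\<close>, the map \<open>fls_const\<close> inside \<open>of_A\<close>, and the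
  embedding of constants inside \<open>evalA\<close>.\<close>

lemma poly_map_poly_mult:
  fixes h :: "'a::comm_ring_1 \<Rightarrow> 'b::comm_ring_1"
  assumes h0: "h 0 = 0" and add: "\<And>x y. h (x + y) = h x + h y" and mult: "\<And>x y. h (x * y) = h x * h y"
  shows "poly (map_poly h (p * q)) x = poly (map_poly h p) x * poly (map_poly h q) x"
proof -
  have s: "poly (map_poly h (Polynomial.smult a q)) x = h a * poly (map_poly h q) x" for a
  proof -
    have "map_poly h (Polynomial.smult a q) = Polynomial.smult (h a) (map_poly h q)"
      by (intro poly_eqI) (simp add: coeff_map_poly h0 mult)
    then show ?thesis by simp
  qed
  show ?thesis
    by (induction p)
      (simp_all add: s map_poly_pCons h0 poly_map_poly_add[OF h0 add] algebra_simps)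
qed

lemma poly_eq_sum_atMost:
  fixes x :: "'a::comm_ring_1"
  assumes "Polynomial.degree p \<le> n"
  shows "poly p x = (\<Sum>i\<le>n. poly.coeff p i * x ^ i)"
  unfolding poly_altdef using assms
  by (intro sum.mono_neutral_left) (auto simp: coeff_eq_0)

lemma CARD_gt_1: "CARD('q::{finite_field,field_gcd}) > 1"
proof -
  have "card {0, 1 :: 'q} \<le> CARD('q)" by (intro card_mono) auto
  then show ?thesis by simp
qed

context C_infinity
begin

abbreviation nrm :: "'c \<Rightarrow> real" where "nrm x \<equiv> dist x 0"

lemma nrm_one: "nrm 1 = 1"
  using abs_mult[of 1 1] by auto

lemma nrm_power: "nrm (x ^ n) = nrm x ^ n"
  by (induction n) (simp_all add: nrm_one abs_mult)

lemma nrm_minus: "nrm (- x) = nrm x"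
  using dist_eq[of 0 x] by (simp add: dist_commute)

lemma nrm_inverse: "nrm (inverse x) = inverse (nrm x)"
proof (cases "x = 0")
  case False
  then have "nrm x * nrm (inverse x) = 1"
    by (simp flip: abs_mult add: nrm_one)
  then show ?thesis using False by (simp add: field_simps)
qed auto

lemma nrm_divide: "nrm (x / y) = nrm x / nrm y"
  by (simp add: divide_inverse abs_mult nrm_inverse)

lemma nrm_add_le: "nrm x \<le> C \<Longrightarrow> nrm y \<le> C \<Longrightarrow> nrm (x + y) \<le> C"
  using abs_ultrametric[of x y] by linarith

lemma nrm_diff_le: "nrm x \<le> C \<Longrightarrow> nrm y \<le> C \<Longrightarrow> nrm (x - y) \<le> C"
  using nrm_add_le[of x C "- y"] by (simp add: nrm_minus)

text \<open>The isosceles principle: writing x as (x + y) + (-y), the ultrametric inequality forbids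
  x + y to be smaller than x, since y alone cannot account for x.\<close>

lemma nrm_add_eq: "nrm y < nrm x \<Longrightarrow> nrm (x + y) = nrm x"
  using abs_ultrametric[of x y] abs_ultrametric[of "x + y" "- y"] by (simp add: nrm_minus)

lemma nrm_sum_le: "(\<And>i. i \<in> I \<Longrightarrow> nrm (h i) \<le> C) \<Longrightarrow> 0 \<le> C \<Longrightarrow> nrm (sum h I) \<le> C"
  by (induction I rule: infinite_finite_induct) (auto intro!: nrm_add_le)

lemma emb_zero: "\<iota> 0 = 0"
  using emb_add[of 0 0] by (metis add.right_neutral add_left_cancel)

lemma emb_minus: "\<iota> (- x) = - \<iota> x"
  using emb_add[of x "-x"] emb_zero by (simp add: eq_neg_iff_add_eq_0 add.commute)

lemma emb_diff: "\<iota> (x - y) = \<iota> x - \<iota> y"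
  using emb_add[of x "-y"] by (simp add: emb_minus)

section \<open>Estimates for polynomial values and roots near approximate roots\<close>

lemma poly_nrm_bound: "\<exists>C>0. \<forall>z. nrm z \<le> R \<longrightarrow> nrm (poly P z) \<le> C"
proof (induction P)
  case 0
  show ?case by (auto intro: exI[of _ 1])
next
  case (pCons a P)
  then obtain C where C: "C > 0" "\<And>z. nrm z \<le> R \<Longrightarrow> nrm (poly P z) \<le> C" by blast
  show ?case
  proof (intro exI[of _ "max (nrm a) (\<bar>R\<bar> * C) + 1"] conjI allI impI)
    fix z assume z: "nrm z \<le> R"
    have "nrm (z * poly P z) \<le> \<bar>R\<bar> * C"
      using z C by (auto simp: abs_mult intro!: mult_mono)
    then show "nrm (poly (pCons a P) z) \<le> max (nrm a) (\<bar>R\<bar> * C) + 1"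
      using abs_ultrametric[of a "z * poly P z"] by simp
  qed (use C in \<open>simp add: add_nonneg_pos le_max_iff_disj\<close>)
qed

text \<open>Provides the passage to the limit in \<open>algebraically_closed\<close>. The Horner
  step uses y P(y) - z P(z) = y (P(y) - P(z)) + (y - z) P(z).\<close>

lemma poly_lipschitz:
  "\<exists>C>0. \<forall>y z. nrm y \<le> R \<longrightarrow> nrm z \<le> R \<longrightarrow> nrm (poly P y - poly P z) \<le> C * nrm (y - z)"
proof (induction P)
  case 0
  show ?case by (auto intro!: exI[of _ 1])
next
  case (pCons a P)
  then obtain C where C: "C > 0"
    "\<And>y z. nrm y \<le> R \<Longrightarrow> nrm z \<le> R \<Longrightarrow> nrm (poly P y - poly P z) \<le> C * nrm (y - z)" by blast
  obtain D where D: "D > 0" "\<And>z. nrm z \<le> R \<Longrightarrow> nrm (poly P z) \<le> D"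
    using poly_nrm_bound by blast
  show ?case
  proof (intro exI[of _ "\<bar>R\<bar> * C + D"] conjI allI impI)
    fix y z assume yz: "nrm y \<le> R" "nrm z \<le> R"
    have "nrm (y * (poly P y - poly P z)) \<le> \<bar>R\<bar> * (C * nrm (y - z))"
      unfolding abs_mult using yz C by (intro mult_mono) auto
    moreover have "nrm ((y - z) * poly P z) \<le> D * nrm (y - z)"
      unfolding abs_mult using D(2)[OF yz(2)] by (subst mult.commute) (intro mult_right_mono, auto)
    ultimately have "nrm (y * (poly P y - poly P z) + (y - z) * poly P z)
        \<le> \<bar>R\<bar> * (C * nrm (y - z)) + D * nrm (y - z)"
      using D C by (intro nrm_add_le) (auto intro: add_increasing add_increasing2)
    then show "nrm (poly (pCons a P) y - poly (pCons a P) z) \<le> (\<bar>R\<bar> * C + D) * nrm (y - z)"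
      by (simp add: algebra_simps)
  qed (use C D in \<open>simp add: add_nonneg_pos\<close>)
qed

text \<open>A monic \<open>p\<close> splits over the algebraic closure, so the absolute value of its
  value at \<open>r\<close> is the product of the \<open>d\<close> distances from \<open>r\<close>
  to the roots. If all of them exceeded \<open>t\<close>, the product would exceed
  \<open>t ^ d\<close>. The induction splits off one root at a time.\<close>

lemma nearby_root:
  assumes "0 \<le> t" "Polynomial.lead_coeff p = 1" "Polynomial.degree p = d" "d > 0"
    "nrm (poly (map_poly \<iota> p) r) \<le> t ^ d"
  shows "\<exists>x. poly p x = 0 \<and> nrm (r - \<iota> x) \<le> t"
  using assms(2-)
proof (induction d arbitrary: p)
  case (Suc d)
  have "p \<noteq> 0" using Suc.prems by auto
  obtain x where x: "poly p x = 0"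
    using alg_closed_imp_poly_has_root[of p] Suc.prems by auto
  then obtain p' where p': "p = [:-x, 1:] * p'" by (auto simp: poly_eq_0_iff_dvd dvd_def)
  then have nz: "p' \<noteq> 0" using \<open>p \<noteq> 0\<close> by auto
  have lc: "Polynomial.lead_coeff p' = 1" using Suc.prems(1) unfolding p' lead_coeff_mult by simp
  have deg: "Polynomial.degree p' = d"
    using Suc.prems(2) nz unfolding p' by (subst (asm) degree_mult_eq) auto
  have "poly (map_poly \<iota> p) r = (r - \<iota> x) * poly (map_poly \<iota> p') r"
    unfolding p' poly_map_poly_mult[of \<iota>, OF emb_zero emb_add emb_mult]
    by (simp add: map_poly_pCons emb_zero emb_one emb_minus)
  then have le: "nrm (r - \<iota> x) * nrm (poly (map_poly \<iota> p') r) \<le> t * t ^ d"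
    using Suc.prems(4) by (simp add: abs_mult)
  show ?case
  proof (cases "nrm (r - \<iota> x) \<le> t")
    case False
    then have lt: "t < nrm (r - \<iota> x)" by simp
    have small: "nrm (poly (map_poly \<iota> p') r) \<le> t ^ d"
    proof (rule ccontr)
      assume "\<not> ?thesis"
      then have "t * t ^ d < nrm (r - \<iota> x) * nrm (poly (map_poly \<iota> p') r)"
        using lt assms(1) by (intro mult_strict_mono') auto
      then show False using le by simp
    qed
    \<comment> \<open>In degree 0 the cofactor is 1, and \<open>le\<close> would bound the distance
      to the only root by \<open>t\<close>, against \<open>lt\<close>.\<close>
    have "d > 0"
    proof (rule ccontr)
      assume "\<not> d > 0"
      then obtain c where "p' = [:c:]" using deg by (auto elim: degree_eq_zeroE)
      then have "p' = 1" using lc by (simp add: one_pCons)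
      then show False using le lt \<open>\<not> d > 0\<close> by (simp add: emb_one nrm_one)
    qed
    then obtain y where "poly p' y = 0" "nrm (r - \<iota> y) \<le> t"
      using Suc.IH[OF lc deg _ small] by blast
    then show ?thesis using p' by auto
  qed (use x in blast)
qed simp

lemma emb_approx: "\<epsilon> > 0 \<Longrightarrow> \<exists>a. nrm (c - \<iota> a) \<le> \<epsilon>"
proof -
  assume "\<epsilon> > 0"
  have "c \<in> closure (range \<iota>)" by (simp add: emb_dense)
  then obtain y where "y \<in> range \<iota>" "dist y c < \<epsilon>"
    using \<open>\<epsilon> > 0\<close> unfolding closure_approachable by blast
  then show ?thesis using dist_eq by (metis dist_commute imageE less_imp_le)
qed

text \<open>One step of a Newton-like iteration: replace \<open>Q\<close> by a close polynomial over the algebraic closure of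
  \<open>K\<^sub>\<infinity>\<close> and move \<open>r\<close> to its nearest root.\<close>

lemma improve_root:
  assumes lc: "Polynomial.lead_coeff Q = 1" and deg: "Polynomial.degree Q = d" and d: "d > 0"
    and M: "M \<ge> 1" "\<And>i. nrm (poly.coeff Q i) \<le> M"
    and r: "nrm r \<le> M" "nrm (poly Q r) \<le> t ^ d" and t: "t > 0" and u: "0 < u" "u \<le> t"
  shows "\<exists>x. nrm x \<le> M \<and> nrm (poly Q x) \<le> u ^ d \<and> nrm (r - x) \<le> t"
proof -
  \<comment> \<open>An error \<open>\<delta>\<close> in every coefficient changes values on the disc
    of radius \<open>M\<close> by at most \<open>u ^ d\<close>; the cap 1 keeps the perturbed
    coefficients bounded by \<open>M\<close>.\<close>
  define \<delta> where "\<delta> = min 1 ((u / M) ^ d)"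
  have \<delta>: "\<delta> > 0" "\<delta> \<le> 1" "\<delta> * M ^ d \<le> u ^ d"
  proof -
    show "\<delta> * M ^ d \<le> u ^ d"
    proof -
      have "\<delta> * M ^ d \<le> (u / M) ^ d * M ^ d"
        using M unfolding \<delta>_def by (intro mult_right_mono) auto
      also have "\<dots> = u ^ d" using M by (simp add: power_divide)
      finally show ?thesis .
    qed
  qed (use u M in \<open>auto simp: \<delta>_def\<close>)
  have "\<forall>i. \<exists>a. nrm (poly.coeff Q i - \<iota> a) \<le> \<delta>" using emb_approx \<delta> by blast
  then obtain a where a: "\<And>i. nrm (poly.coeff Q i - \<iota> (a i)) \<le> \<delta>" by metis
  \<comment> \<open>The top coefficient is not approximated but set to 1, so that \<open>p\<close>
    is monic of degree \<open>d\<close> as \<open>nearby_root\<close> demands.\<close>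
  define p where "p = Poly (map (\<lambda>i. if i = d then 1 else a i) [0..<Suc d])"
  have cp: "poly.coeff p i = (if i < d then a i else if i = d then 1 else 0)" for i
    by (auto simp: p_def nth_default_def nth_append simp del: upt_Suc)
  have degp: "Polynomial.degree p = d"
    by (rule antisym; (rule degree_le le_degree)) (auto simp: cp)
  have lcp: "Polynomial.lead_coeff p = 1" by (simp add: degp cp)
  define q where "q = map_poly \<iota> p"
  have cq: "poly.coeff q i = \<iota> (poly.coeff p i)" for i
    by (simp add: q_def coeff_map_poly emb_zero)
  have close: "nrm (poly.coeff Q i - poly.coeff q i) \<le> \<delta>" for i
    using a[of i] lc deg \<delta> coeff_eq_0[of Q i]
    by (auto simp: cq cp emb_one emb_zero)
  have close_val: "nrm (poly Q z - poly q z) \<le> u ^ d" if z: "nrm z \<le> M" for z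
  proof -
    have "Polynomial.degree (Q - q) \<le> d"
      using deg by (intro degree_le) (auto simp: cq cp emb_zero coeff_eq_0)
    then have "poly Q z - poly q z = (\<Sum>i\<le>d. poly.coeff (Q - q) i * z ^ i)"
      by (simp flip: poly_diff add: poly_eq_sum_atMost)
    also have "nrm \<dots> \<le> \<delta> * M ^ d"
    proof (rule nrm_sum_le)
      fix i assume i: "i \<in> {..d}"
      have "nrm z ^ i \<le> M ^ d"
        using z M i by (intro order.trans[OF power_mono[of _ M] power_increasing]) auto
      then show "nrm (poly.coeff (Q - q) i * z ^ i) \<le> \<delta> * M ^ d"
        using close[of i] \<delta> by (auto simp: abs_mult nrm_power intro!: mult_mono)
    qed (use \<delta> M in auto)
    finally show ?thesis using \<delta> by simp
  qed
  have "nrm (poly q r) \<le> t ^ d"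
  proof -
    have "nrm (poly Q r - (poly Q r - poly q r)) \<le> t ^ d"
      by (rule nrm_diff_le) (use r close_val[OF r(1)] power_mono[OF u(2), of d] u in auto)
    then show ?thesis by simp
  qed
  then obtain y where y: "poly p y = 0" "nrm (r - \<iota> y) \<le> t"
    using nearby_root[of t p d r] lcp degp d t by (auto simp: q_def)
  have q0: "poly q (\<iota> y) = 0"
  proof -
    have "poly (map_poly \<iota> p') (\<iota> y) = \<iota> (poly p' y)" for p'
      by (induction p') (simp_all add: map_poly_pCons emb_zero emb_add emb_mult)
    then show ?thesis using y by (simp add: q_def emb_zero)
  qed
  \<comment> \<open>Cauchy's root bound: if y were larger than \<open>M\<close>, the term
    \<open>\<iota> y ^ d\<close> would dominate all lower terms, and they could not cancel
    it.\<close>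
  have yM: "nrm (\<iota> y) \<le> M"
  proof (rule ccontr)
    assume "\<not> ?thesis"
    then have gt: "M < nrm (\<iota> y)" by simp
    let ?Y = "nrm (\<iota> y)"
    have "poly q (\<iota> y) = (\<Sum>i\<le>d. poly.coeff q i * \<iota> y ^ i)"
      by (intro poly_eq_sum_atMost degree_le) (auto simp: cq cp emb_zero)
    also have "\<dots> = (\<Sum>i<d. poly.coeff q i * \<iota> y ^ i) + \<iota> y ^ d"
      by (simp add: lessThan_Suc_atMost[symmetric] cq cp emb_one)
    finally have "\<iota> y ^ d = - (\<Sum>i<d. poly.coeff q i * \<iota> y ^ i)" using q0 by (simp add: eq_neg_iff_add_eq_0 add.commute)
    then have "?Y ^ d = nrm (\<Sum>i<d. poly.coeff q i * \<iota> y ^ i)"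
      by (metis nrm_minus nrm_power)
    also have "\<dots> \<le> M * ?Y ^ (d - 1)"
    proof (rule nrm_sum_le)
      fix i assume i: "i \<in> {..<d}"
      have "nrm (poly.coeff Q i - (poly.coeff Q i - poly.coeff q i)) \<le> M"
        by (rule nrm_diff_le) (use M(2)[of i] close[of i] \<delta> M(1) in auto)
      then show "nrm (poly.coeff q i * \<iota> y ^ i) \<le> M * ?Y ^ (d - 1)"
        using gt M i by (auto simp: abs_mult nrm_power intro!: mult_mono power_increasing)
    qed (use M in auto)
    also have "\<dots> < ?Y * ?Y ^ (d - 1)" using gt M(1) by (intro mult_strict_right_mono zero_less_power) linarith+
    also have "\<dots> = ?Y ^ d" using d by (cases d) auto
    finally show False by simp
  qed
  have "nrm (poly Q (\<iota> y)) \<le> u ^ d" using close_val[OF yM] q0 by simp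
  with y yM show ?thesis by blast
qed

end

section \<open>Algebraic closedness and boundedness of analytic functions\<close>

context C_infinity
begin

text \<open>After normalising to a monic polynomial, \<open>improve_root\<close> is iterated with
  tolerances tending to 0. The approximate roots form a Cauchy sequence, whose limit exists by
  completeness and is a root because evaluation is Lipschitz on bounded sets.\<close>

lemma algebraically_closed:
  assumes "Polynomial.degree Q > 0"
  shows "\<exists>x. poly Q x = (0 :: 'c)"
proof -
  define c where "c = Polynomial.lead_coeff Q"
  have c: "c \<noteq> 0" using assms by (auto simp: c_def)
  define P where "P = Polynomial.smult (inverse c) Q"
  define d where "d = Polynomial.degree P"
  have lc: "Polynomial.lead_coeff P = 1" and d: "d > 0"
    using c assms by (auto simp: P_def d_def c_def)
  define M where "M = Max (insert 1 ((\<lambda>i. nrm (poly.coeff P i)) ` {..d}))"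
  have M1: "M \<ge> 1" by (auto simp: M_def)
  have MP: "nrm (poly.coeff P i) \<le> M" for i
  proof (cases "i \<le> d")
    case True
    then show ?thesis unfolding M_def by (intro Max_ge) auto
  next
    case False
    then show ?thesis using M1 by (simp add: coeff_eq_0 d_def)
  qed
  \<comment> \<open>Starting at \<open>M\<close> makes 0 an admissible first approximation: its
    value is the constant coefficient, bounded by \<open>M\<close> and hence by
    \<open>M ^ d\<close>.\<close>
  define T where "T n = M / 2 ^ n" for n :: nat
  have T: "T n > 0" "T (Suc n) \<le> T n" for n using M1 by (auto simp: T_def field_simps)
  have "\<exists>r. \<forall>n. (nrm (r n) \<le> M \<and> nrm (poly P (r n)) \<le> T n ^ d) \<and> nrm (r n - r (Suc n)) \<le> T n"
  proof (rule dependent_nat_choice)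
    have "nrm (poly P 0) \<le> M ^ d"
      using MP[of 0] M1 power_increasing[of 1 d M] d by (simp add: poly_0_coeff_0)
    then show "\<exists>x. nrm x \<le> M \<and> nrm (poly P x) \<le> T 0 ^ d"
      using M1 by (intro exI[of _ 0]) (simp add: T_def)
  next
    fix x n assume "nrm x \<le> M \<and> nrm (poly P x) \<le> T n ^ d"
    then show "\<exists>y. (nrm y \<le> M \<and> nrm (poly P y) \<le> T (Suc n) ^ d) \<and> nrm (x - y) \<le> T n"
      using improve_root[OF lc d_def[symmetric] d M1 MP, of x "T n" "T (Suc n)"] T by blast
  qed
  then obtain r where r: "\<And>n. nrm (r n) \<le> M" "\<And>n. nrm (poly P (r n)) \<le> T n ^ d"
    "\<And>n. nrm (r n - r (Suc n)) \<le> T n" by blast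
  have anti: "T n \<le> T k" if "k \<le> n" for k n
    using T(2) that by (rule lift_Suc_antimono_le)
  \<comment> \<open>By the ultrametric inequality the largest single step, the first one, bounds the
    total distance.\<close>
  have near: "nrm (r n - r (n + j)) \<le> T n" for n j
  proof (induction j)
    case (Suc j)
    have "nrm ((r n - r (n + j)) + (r (n + j) - r (Suc (n + j)))) \<le> T n"
      using Suc r(3)[of "n + j"] anti[of n "n + j"] by (intro nrm_add_le) auto
    then show ?case by simp
  qed (use T(1)[of n] in simp)
  have T0: "T \<longlonglongrightarrow> 0"
    unfolding T_def by (rule LIMSEQ_divide_realpow_zero) simp
  have "Cauchy r"
    unfolding Cauchy_altdef2
  proof (intro allI impI)
    fix e :: real assume "e > 0"
    then obtain N where N: "T N < e"
      using order_tendstoD(2)[OF T0] by (auto simp: eventually_sequentially)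
    have "dist (r n) (r N) < e" if "n \<ge> N" for n
      using near[of N "n - N"] that N dist_eq[of "r N" "r n"] by (simp add: dist_commute)
    then show "\<exists>N. \<forall>n\<ge>N. dist (r n) (r N) < e" by blast
  qed
  then obtain x where x: "r \<longlonglongrightarrow> x"
    by (auto simp: Cauchy_convergent_iff convergent_def)
  have dx: "(\<lambda>n. nrm (r n - x)) \<longlonglongrightarrow> 0"
    using tendsto_dist_iff[THEN iffD1, OF x] by (simp flip: dist_eq)
  have xM: "nrm x \<le> M"
    using r(1) by (intro LIMSEQ_le_const2[OF tendsto_dist[OF x tendsto_const]]) auto
  obtain C where C: "C > 0" "\<And>y z. nrm y \<le> M \<Longrightarrow> nrm z \<le> M \<Longrightarrow>
      nrm (poly P y - poly P z) \<le> C * nrm (y - z)"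
    using poly_lipschitz by blast
  have "nrm (poly P x) \<le> T n ^ d + C * nrm (r n - x)" for n
  proof -
    have "nrm (poly P (r n) - (poly P (r n) - poly P x)) \<le> T n ^ d + C * nrm (r n - x)"
      by (rule nrm_diff_le)
        (use r(2)[of n] C(1) less_imp_le[OF T(1)[of n]] C(2)[OF r(1) xM, of n] in
          \<open>auto intro: add_increasing add_increasing2\<close>)
    then show ?thesis by simp
  qed
  moreover have lim: "(\<lambda>n. T n ^ d + C * nrm (r n - x)) \<longlonglongrightarrow> 0 ^ d + C * 0"
    by (intro tendsto_intros T0 dx)
  ultimately have "nrm (poly P x) \<le> 0 ^ d + C * 0"
    using LIMSEQ_le_const[OF lim] by blast
  then have "poly P x = 0" using d by (simp add: zero_power)
  then show ?thesis using c by (auto simp: P_def)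
qed

text \<open>The hypothesis on \<open>S\<close> holds for \<open>\<Omega>\<^sub>n\<close> because the absolute value is non-archimedean.\<close>

lemma poly_bounded_below:
  assumes "\<rho> > 0" and thick: "\<And>x z. z \<in> S \<Longrightarrow> x \<notin> S \<Longrightarrow> nrm (z - x) \<ge> \<rho>"
    and "\<And>z. z \<in> S \<Longrightarrow> poly Q z \<noteq> 0" and "Q \<noteq> 0"
  shows "\<exists>c>0. \<forall>z\<in>S. c \<le> nrm (poly Q z)"
  using assms(3,4)
proof (induction "Polynomial.degree Q" arbitrary: Q)
  case 0
  then obtain a where "Q = [:a:]" by (auto elim: degree_eq_zeroE)
  with 0 show ?case by (intro exI[of _ "nrm a"]) auto
next
  case (Suc d)
  obtain x where x: "poly Q x = 0" using algebraically_closed[of Q] Suc by auto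
  then obtain Q' where Q': "Q = [:-x, 1:] * Q'" by (auto simp: poly_eq_0_iff_dvd dvd_def)
  then have nz: "Q' \<noteq> 0" using Suc by auto
  have "Suc (Polynomial.degree Q') = Polynomial.degree Q"
    using nz unfolding Q' by (subst degree_mult_eq) auto
  then have "d = Polynomial.degree Q'" using Suc by simp
  moreover have "poly Q' z \<noteq> 0" if "z \<in> S" for z using Suc.prems(1)[OF that] Q' by auto
  ultimately obtain c where c: "c > 0" "\<And>z. z \<in> S \<Longrightarrow> c \<le> nrm (poly Q' z)"
    using Suc.hyps nz by blast
  \<comment> \<open>The root split off lies outside \<open>S\<close>, so its linear factor
    contributes at least \<open>\<rho>\<close>.\<close>
  have "\<rho> * c \<le> nrm (poly Q z)" if z: "z \<in> S" for z
  proof -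
    have "poly Q z = (z - x) * poly Q' z" unfolding Q' by (simp add: algebra_simps)
    moreover have "x \<notin> S" using x Suc.prems by blast
    ultimately show ?thesis
      using thick[OF z] c z \<open>\<rho> > 0\<close> by (auto simp: abs_mult intro!: mult_mono)
  qed
  then show ?case using c \<open>\<rho> > 0\<close> by (intro exI[of _ "\<rho> * c"]) auto
qed

section \<open>The field of Laurent series inside its completed closure, the imaginary absolute
  value and the affinoids\<close>

lemma K_to_C_zero [simp]: "K_to_C \<iota> 0 = 0"
  and K_to_C_one [simp]: "K_to_C \<iota> 1 = 1"
  and K_to_C_add: "K_to_C \<iota> (x + y) = K_to_C \<iota> x + K_to_C \<iota> y"
  and K_to_C_diff: "K_to_C \<iota> (x - y) = K_to_C \<iota> x - K_to_C \<iota> y"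
  and K_to_C_minus: "K_to_C \<iota> (- x) = - K_to_C \<iota> x"
  and K_to_C_mult: "K_to_C \<iota> (x * y) = K_to_C \<iota> x * K_to_C \<iota> y"
  by (simp_all add: K_to_C_def emb_zero emb_one emb_add emb_diff emb_minus emb_mult)

lemma K_to_C_inverse: "K_to_C \<iota> (inverse x) = inverse (K_to_C \<iota> x)"
proof (cases "x = 0")
  case False
  then have "K_to_C \<iota> x * K_to_C \<iota> (inverse x) = 1" by (simp flip: K_to_C_mult)
  then show ?thesis by (simp add: inverse_unique)
qed auto

lemma K_to_C_divide: "K_to_C \<iota> (x / y) = K_to_C \<iota> x / K_to_C \<iota> y"
  by (simp add: divide_inverse K_to_C_mult K_to_C_inverse)

lemma K_to_C_eq_0_iff [simp]: "K_to_C \<iota> x = 0 \<longleftrightarrow> x = 0"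
proof
  assume *: "K_to_C \<iota> x = 0"
  show "x = 0"
  proof (rule ccontr)
    assume "x \<noteq> 0"
    then have "K_to_C \<iota> x * K_to_C \<iota> (inverse x) = 1" by (simp flip: K_to_C_mult)
    with * show False by simp
  qed
qed auto

lemma nrm_K_to_C: "nrm (K_to_C \<iota> x) = absK x"
  by (simp add: K_to_C_def emb_abs)

text \<open>Trades the infimum for a condition on every point of the Laurent series field, the form
  in which all lower bounds on the imaginary absolute value are proved below.\<close>

lemma le_im_abs_iff: "r \<le> im_abs \<iota> z \<longleftrightarrow> (\<forall>x. r \<le> nrm (z - K_to_C \<iota> x))"
proof -
  have "im_abs \<iota> z = (INF x. nrm (z - K_to_C \<iota> x))"
    unfolding im_abs_def infdist_def by (simp add: image_image flip: dist_eq)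
  then show ?thesis by (simp add: le_cINF_iff bdd_below.I2[of _ 0])
qed

lemma im_abs_pos_imp_Omega: "im_abs \<iota> z > 0 \<Longrightarrow> z \<in> Omega \<iota>"
  by (auto simp: Omega_def im_abs_def)

lemma im_abs_translate: "im_abs \<iota> (z + K_to_C \<iota> x) = im_abs \<iota> z"
proof -
  have "r \<le> im_abs \<iota> (z + K_to_C \<iota> x) \<longleftrightarrow> r \<le> im_abs \<iota> z" for r
  proof
    assume *: "r \<le> im_abs \<iota> (z + K_to_C \<iota> x)"
    show "r \<le> im_abs \<iota> z" unfolding le_im_abs_iff
    proof
      fix y show "r \<le> nrm (z - K_to_C \<iota> y)"
        using *[unfolded le_im_abs_iff, THEN spec, of "y + x"] by (simp add: K_to_C_add)
    qed
  next
    assume *: "r \<le> im_abs \<iota> z"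
    show "r \<le> im_abs \<iota> (z + K_to_C \<iota> x)" unfolding le_im_abs_iff
    proof
      fix y show "r \<le> nrm (z + K_to_C \<iota> x - K_to_C \<iota> y)"
        using *[unfolded le_im_abs_iff, THEN spec, of "y - x"]
        by (simp add: K_to_C_diff algebra_simps)
    qed
  qed
  then show ?thesis by (meson order.refl order.antisym)
qed

lemma q_gt_1: "real CARD('q) > 1"
  using CARD_gt_1[where 'q = 'q] by simp

lemma Omega_aff_iff:
  "z \<in> Omega_aff \<iota> n \<longleftrightarrow> nrm z \<le> real CARD('q) ^ n \<and> (\<forall>x. 1 / real CARD('q) ^ n \<le> nrm (z - K_to_C \<iota> x))"
  by (simp add: Omega_aff_def le_im_abs_iff)

text \<open>This is the hypothesis on \<open>S\<close> in \<open>poly_bounded_below\<close>. A shift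
  of \<open>z\<close> smaller than \<open>1 / q ^ n\<close> stays in the disc and, by the isosceles
  principle, changes no distance to a Laurent series, since all these distances are at least
  \<open>1 / q ^ n\<close>.\<close>

lemma Omega_aff_thick:
  assumes z: "z \<in> Omega_aff \<iota> n" and x: "x \<notin> Omega_aff \<iota> n"
  shows "nrm (z - x) \<ge> 1 / real CARD('q) ^ n"
proof (rule ccontr)
  assume "\<not> ?thesis"
  then have lt: "nrm (x - z) < 1 / real CARD('q) ^ n"
    using nrm_minus[of "z - x"] by simp
  have "1 / real CARD('q) ^ n \<le> real CARD('q) ^ n"
    using q_gt_1 by (auto intro: order.trans[of _ 1])
  then have "nrm (z + (x - z)) \<le> real CARD('q) ^ n"
    using z lt by (intro nrm_add_le) (auto simp: Omega_aff_iff)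
  moreover have "nrm (x - K_to_C \<iota> y) = nrm (z - K_to_C \<iota> y)" for y
  proof -
    have "nrm (x - z) < nrm (z - K_to_C \<iota> y)"
      using lt z[unfolded Omega_aff_iff] by (meson order.strict_trans2)
    then show ?thesis using nrm_add_eq[of "x - z" "z - K_to_C \<iota> y"] by simp
  qed
  ultimately have "x \<in> Omega_aff \<iota> n" using z by (simp add: Omega_aff_iff)
  with x show False by simp
qed

text \<open>One approximating quotient at distance less than 1 from \<open>f\<close> is enough: its
  numerator is bounded on the disc and its denominator is bounded below on the affinoid.\<close>

lemma rigid_analytic_bounded:
  assumes "rigid_analytic \<iota> f"
  shows "\<exists>C. \<forall>z\<in>Omega_aff \<iota> n. nrm (f z) \<le> C"
proof (cases "Omega_aff \<iota> n = {}")
  case False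
  then obtain z0 where z0: "z0 \<in> Omega_aff \<iota> n" by blast
  obtain P Q where Q: "\<And>i z. z\<in>Omega_aff \<iota> n \<Longrightarrow> poly (Q i) z \<noteq> 0" and
    lim: "uniform_limit (Omega_aff \<iota> n) (\<lambda>i z. poly (P i) z / poly (Q i) z) f sequentially"
    using assms unfolding rigid_analytic_def by blast
  obtain i where i: "\<And>z. z \<in> Omega_aff \<iota> n \<Longrightarrow> dist (poly (P i) z / poly (Q i) z) (f z) < 1"
    using lim[unfolded uniform_limit_iff, rule_format, of 1] by (auto simp: eventually_sequentially)
  have pos: "1 / real CARD('q) ^ n > 0" using q_gt_1 by simp
  \<comment> \<open>This takes a point of the affinoid: on the empty set even the zero polynomial is
    free of zeros.\<close>
  have "Q i \<noteq> 0" using Q[OF z0, of i] by auto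
  then obtain c where c: "c > 0" "\<And>z. z \<in> Omega_aff \<iota> n \<Longrightarrow> c \<le> nrm (poly (Q i) z)"
    using poly_bounded_below[OF pos, of "Omega_aff \<iota> n" "Q i"] Omega_aff_thick Q by blast
  obtain D where D: "D > 0" "\<And>z. nrm z \<le> real CARD('q) ^ n \<Longrightarrow> nrm (poly (P i) z) \<le> D"
    using poly_nrm_bound by blast
  have "nrm (f z) \<le> D / c + 1" if z: "z \<in> Omega_aff \<iota> n" for z
  proof -
    have "nrm (poly (P i) z / poly (Q i) z) \<le> D / c"
      unfolding nrm_divide using c D z by (intro frac_le) (auto simp: Omega_aff_iff)
    then show ?thesis
      using dist_triangle3[of "f z" 0 "poly (P i) z / poly (Q i) z"] i[OF z] by linarith
  qed
  then show ?thesis by blast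
qed auto

end

section \<open>Rigid analytic functions\<close>

lemma of_A_pCons: "of_A (pCons c p) = fls_const c + fls_X_inv * of_A p"
  by (simp add: of_A_def map_poly_pCons)

text \<open>Since theta is the inverse of the series variable, the coefficient of its i-th power
  sits at index -i.\<close>

lemma of_A_nth: "fls_nth (of_A p) k = (if k \<le> 0 then poly.coeff p (nat (- k)) else 0)"
proof (induction p arbitrary: k)
  case 0
  show ?case by (simp add: of_A_def)
next
  case (pCons c p)
  show ?case
  proof (cases "k < 0")
    case True
    then have "nat (- k) = Suc (nat (- 1 - k))" by simp
    then show ?thesis using True pCons.IH
      by (simp add: of_A_pCons fls_X_inv_times_conv_shift algebra_simps)
  qed (auto simp: of_A_pCons fls_X_inv_times_conv_shift pCons.IH)
qed

lemma of_A_zero [simp]: "of_A 0 = 0"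
  and of_A_one [simp]: "of_A 1 = 1"
  and of_A_add: "of_A (a + b) = of_A a + of_A b"
  and of_A_mult: "of_A (a * b) = of_A a * of_A b"
  unfolding of_A_def
  by (simp_all add: poly_map_poly_add poly_map_poly_mult fls_plus_const fls_const_mult_const one_pCons map_poly_pCons)

lemma of_A_diff: "of_A (a - b) = of_A a - of_A b"
  using of_A_add[of "a - b" b] by (simp add: algebra_simps)

lemma of_A_eq_0_iff [simp]: "of_A a = 0 \<longleftrightarrow> a = 0"
proof
  assume "of_A a = 0"
  then have "poly.coeff a i = 0" for i using of_A_nth[of a "- int i"] by simp
  then show "a = 0" by (intro poly_eqI) simp
qed simp

text \<open>Removing the polynomial part leaves a power series in 1/theta. This later brings points
  into a bounded set by translations from an ideal of A.\<close>

lemma polynomial_part: "\<exists>a. absK (y - of_A a) \<le> 1"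
proof -
  \<comment> \<open>For i at least \<open>N\<close> the index -i lies below the subdegree, so all
    coefficients cut off are zero; \<open>nat\<close> covers the case of positive subdegree.\<close>
  define N where "N = Suc (nat (- fls_subdegree y))"
  define a where "a = Poly (map (\<lambda>i. fls_nth y (- int i)) [0..<N])"
  have "fls_nth (of_A a) k = fls_nth y k" if k: "k < 0" for k
  proof (cases "nat (- k) < N")
    case False
    then have "k < fls_subdegree y" using k unfolding N_def by linarith
    then show ?thesis using False k by (simp add: of_A_nth a_def nth_default_def del: upt_Suc)
  qed (use k in \<open>simp add: of_A_nth a_def nth_default_def del: upt_Suc\<close>)
  then have z: "fls_nth (y - of_A a) k = 0" if "k < 0" for k using that by simp
  have "fls_subdegree (y - of_A a) \<ge> 0" if "y - of_A a \<noteq> 0"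
    using that z[of "fls_subdegree (y - of_A a)"] nth_fls_subdegree_nonzero[OF that] by fastforce
  moreover have "real CARD('a) \<ge> 1"
    using finite_UNIV_card_ge_0[where 'a = 'a] by (simp add: Suc_le_eq)
  ultimately have "absK (y - of_A a) \<le> 1"
    unfolding absK_def by (auto simp: power_int_minus inverse_le_1_iff)
  then show ?thesis by blast
qed

context C_infinity
begin

section \<open>Closure properties of rigid analytic functions\<close>

lemma rigid_analytic_cmult:
  assumes "rigid_analytic \<iota> f"
  shows "rigid_analytic \<iota> (\<lambda>z. c * f z)"
  unfolding rigid_analytic_def
proof
  fix n
  obtain P Q where Q: "\<And>i z. z\<in>Omega_aff \<iota> n \<Longrightarrow> poly (Q i) z \<noteq> 0" and
    lim: "uniform_limit (Omega_aff \<iota> n) (\<lambda>i z. poly (P i) z / poly (Q i) z) f sequentially"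
    using assms unfolding rigid_analytic_def by blast
  have "uniform_limit (Omega_aff \<iota> n) (\<lambda>i z. poly (Polynomial.smult c (P i)) z / poly (Q i) z) (\<lambda>z. c * f z) sequentially"
    unfolding uniform_limit_iff
  proof (intro allI impI)
    fix e :: real assume e: "e > 0"
    \<comment> \<open>Adding 1 keeps the quotient meaningful when \<open>c\<close> is zero.\<close>
    have "e / (nrm c + 1) > 0" using e by (simp add: add_nonneg_pos)
    then have "\<forall>\<^sub>F i in sequentially. \<forall>z\<in>Omega_aff \<iota> n. dist (poly (P i) z / poly (Q i) z) (f z) < e / (nrm c + 1)"
      using lim unfolding uniform_limit_iff by blast
    then show "\<forall>\<^sub>F i in sequentially. \<forall>z\<in>Omega_aff \<iota> n.
        dist (poly (Polynomial.smult c (P i)) z / poly (Q i) z) (c * f z) < e"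
    proof (rule eventually_mono, intro ballI)
      fix i z assume "\<forall>z\<in>Omega_aff \<iota> n. dist (poly (P i) z / poly (Q i) z) (f z) < e / (nrm c + 1)"
        and "z \<in> Omega_aff \<iota> n"
      then have lt: "nrm (poly (P i) z / poly (Q i) z - f z) < e / (nrm c + 1)" by (simp flip: dist_eq)
      have "dist (poly (Polynomial.smult c (P i)) z / poly (Q i) z) (c * f z) = nrm c * nrm (poly (P i) z / poly (Q i) z - f z)"
        by (subst dist_eq) (simp flip: abs_mult add: algebra_simps)
      also have "\<dots> \<le> (nrm c + 1) * nrm (poly (P i) z / poly (Q i) z - f z)"
        by (intro mult_right_mono) auto
      also have "\<dots> < e" using lt by (subst (asm) pos_less_divide_eq) (simp_all add: add_nonneg_pos mult.commute)
      finally show "dist (poly (Polynomial.smult c (P i)) z / poly (Q i) z) (c * f z) < e" .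
    qed
  qed
  with Q show "\<exists>P Q. (\<forall>i. \<forall>z\<in>Omega_aff \<iota> n. poly (Q i) z \<noteq> 0) \<and>
      uniform_limit (Omega_aff \<iota> n) (\<lambda>i z. poly (P i) z / poly (Q i) z) (\<lambda>z. c * f z) sequentially"
    by (intro exI[of _ "\<lambda>i. Polynomial.smult c (P i)"] exI[of _ Q]) auto
qed

lemma rigid_analytic_add:
  assumes "rigid_analytic \<iota> f" "rigid_analytic \<iota> g"
  shows "rigid_analytic \<iota> (\<lambda>z. f z + g z)"
  unfolding rigid_analytic_def
proof
  fix n
  obtain P Q where Q: "\<And>i z. z\<in>Omega_aff \<iota> n \<Longrightarrow> poly (Q i) z \<noteq> 0" and
    lim: "uniform_limit (Omega_aff \<iota> n) (\<lambda>i z. poly (P i) z / poly (Q i) z) f sequentially"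
    using assms(1) unfolding rigid_analytic_def by blast
  obtain P' Q' where Q': "\<And>i z. z\<in>Omega_aff \<iota> n \<Longrightarrow> poly (Q' i) z \<noteq> 0" and
    lim': "uniform_limit (Omega_aff \<iota> n) (\<lambda>i z. poly (P' i) z / poly (Q' i) z) g sequentially"
    using assms(2) unfolding rigid_analytic_def by blast
  have "uniform_limit (Omega_aff \<iota> n)
     (\<lambda>i z. poly (P i * Q' i + P' i * Q i) z / poly (Q i * Q' i) z) (\<lambda>z. f z + g z) sequentially"
    unfolding uniform_limit_iff
  proof (intro allI impI)
    fix e :: real assume e: "e > 0"
    \<comment> \<open>Both errors may be as large as the target \<open>e\<close>, because the
      ultrametric inequality takes their maximum.\<close>
    have "\<forall>\<^sub>F i in sequentially. \<forall>z\<in>Omega_aff \<iota> n. dist (poly (P i) z / poly (Q i) z) (f z) < e"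
      using lim e unfolding uniform_limit_iff by blast
    moreover have "\<forall>\<^sub>F i in sequentially. \<forall>z\<in>Omega_aff \<iota> n. dist (poly (P' i) z / poly (Q' i) z) (g z) < e"
      using lim' e unfolding uniform_limit_iff by blast
    ultimately show "\<forall>\<^sub>F i in sequentially. \<forall>z\<in>Omega_aff \<iota> n.
        dist (poly (P i * Q' i + P' i * Q i) z / poly (Q i * Q' i) z) (f z + g z) < e"
    proof eventually_elim
      case (elim i)
      show ?case
      proof
        fix z assume z: "z \<in> Omega_aff \<iota> n"
        have "poly (P i * Q' i + P' i * Q i) z / poly (Q i * Q' i) z - (f z + g z) =
            (poly (P i) z / poly (Q i) z - f z) + (poly (P' i) z / poly (Q' i) z - g z)"
          using Q[OF z] Q'[OF z] by (simp add: field_simps)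
        moreover have "nrm (poly (P i) z / poly (Q i) z - f z) < e"
          "nrm (poly (P' i) z / poly (Q' i) z - g z) < e"
          using elim z by (simp_all flip: dist_eq)
        ultimately have "nrm (poly (P i * Q' i + P' i * Q i) z / poly (Q i * Q' i) z - (f z + g z)) < e"
          using abs_ultrametric[of "poly (P i) z / poly (Q i) z - f z" "poly (P' i) z / poly (Q' i) z - g z"]
          by (simp only: max_less_iff_conj order.strict_trans1)
        then show "dist (poly (P i * Q' i + P' i * Q i) z / poly (Q i * Q' i) z) (f z + g z) < e"
          by (simp only: dist_eq[of "_ / _" "f z + g z"])
      qed
    qed
  qed
  with Q Q' show "\<exists>P Q. (\<forall>i. \<forall>z\<in>Omega_aff \<iota> n. poly (Q i) z \<noteq> 0) \<and>
      uniform_limit (Omega_aff \<iota> n) (\<lambda>i z. poly (P i) z / poly (Q i) z) (\<lambda>z. f z + g z) sequentially"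
    by (intro exI[of _ "\<lambda>i. P i * Q' i + P' i * Q i"] exI[of _ "\<lambda>i. Q i * Q' i"]) auto
qed

lemma rigid_analytic_zero: "rigid_analytic \<iota> (\<lambda>z. 0)"
  unfolding rigid_analytic_def
  by (intro allI exI[of _ "\<lambda>_. 0"] exI[of _ "\<lambda>_. 1"]) (auto simp: uniform_limit_iff)

lemma rigid_analytic_sum:
  "(\<And>i. i \<in> I \<Longrightarrow> rigid_analytic \<iota> (f i)) \<Longrightarrow> rigid_analytic \<iota> (\<lambda>z. \<Sum>i\<in>I. f i z)"
  by (induction I rule: infinite_finite_induct) (auto intro: rigid_analytic_zero rigid_analytic_add)

lemma le_q_power: "\<exists>n. r \<le> real CARD('q) ^ n"
  using real_arch_pow[OF q_gt_1, of r] less_imp_le by blast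

lemma region_subset_Omega_aff:
  assumes "\<epsilon> > 0"
  shows "\<exists>n. \<forall>z. nrm z \<le> R \<longrightarrow> \<epsilon> \<le> im_abs \<iota> z \<longrightarrow> z \<in> Omega_aff \<iota> n"
proof -
  obtain n where n: "max R (1 / \<epsilon>) \<le> real CARD('q) ^ n" using le_q_power by blast
  have "1 / real CARD('q) ^ n \<le> \<epsilon>" using n assms q_gt_1 by (simp add: field_simps)
  then show ?thesis using n by (intro exI[of _ n]) (auto simp: Omega_aff_def)
qed

text \<open>A translation by a Laurent series preserves the distance to the Laurent series and
  enlarges the modulus at most to that of \<open>x\<close>. It thus maps each affinoid into a larger
  one, whose approximants are composed with the translation.\<close>

lemma rigid_analytic_translate:
  assumes "rigid_analytic \<iota> f"
  shows "rigid_analytic \<iota> (\<lambda>z. f (z + K_to_C \<iota> x))"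
  unfolding rigid_analytic_def
proof
  fix n
  have pos: "1 / real CARD('q) ^ n > 0" using q_gt_1 by simp
  obtain N where N: "\<And>z. nrm z \<le> max (real CARD('q) ^ n) (absK x) \<Longrightarrow> 1 / real CARD('q) ^ n \<le> im_abs \<iota> z \<Longrightarrow> z \<in> Omega_aff \<iota> N"
    using region_subset_Omega_aff[OF pos] by blast
  have shift: "z + K_to_C \<iota> x \<in> Omega_aff \<iota> N" if "z \<in> Omega_aff \<iota> n" for z
    using that by (intro N nrm_add_le) (auto simp: Omega_aff_def im_abs_translate nrm_K_to_C)
  obtain P Q where Q: "\<And>i z. z\<in>Omega_aff \<iota> N \<Longrightarrow> poly (Q i) z \<noteq> 0" and
    lim: "uniform_limit (Omega_aff \<iota> N) (\<lambda>i z. poly (P i) z / poly (Q i) z) f sequentially"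
    using assms unfolding rigid_analytic_def by blast
  have "uniform_limit (Omega_aff \<iota> n) (\<lambda>i z. poly (P i) (z + K_to_C \<iota> x) / poly (Q i) (z + K_to_C \<iota> x))
     (\<lambda>z. f (z + K_to_C \<iota> x)) sequentially"
    unfolding uniform_limit_iff
  proof (intro allI impI)
    fix e :: real assume "e > 0"
    with lim have "\<forall>\<^sub>F i in sequentially. \<forall>z\<in>Omega_aff \<iota> N. dist (poly (P i) z / poly (Q i) z) (f z) < e"
      unfolding uniform_limit_iff by blast
    then show "\<forall>\<^sub>F i in sequentially. \<forall>z\<in>Omega_aff \<iota> n.
        dist (poly (P i) (z + K_to_C \<iota> x) / poly (Q i) (z + K_to_C \<iota> x)) (f (z + K_to_C \<iota> x)) < e"
      by (rule eventually_mono) (use shift in blast)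
  qed
  with Q shift show "\<exists>P Q. (\<forall>i. \<forall>z\<in>Omega_aff \<iota> n. poly (Q i) z \<noteq> 0) \<and>
      uniform_limit (Omega_aff \<iota> n) (\<lambda>i z. poly (P i) z / poly (Q i) z) (\<lambda>z. f (z + K_to_C \<iota> x)) sequentially"
    by (intro exI[of _ "\<lambda>i. pcompose (P i) [:K_to_C \<iota> x, 1:]"] exI[of _ "\<lambda>i. pcompose (Q i) [:K_to_C \<iota> x, 1:]"])
      (auto simp: poly_pcompose add.commute)
qed

end

section \<open>Slash operators and boundedness at the cusps\<close>

lemma mat2_nth [simp]:
  "mat2 a b c d $ 1 $ 1 = a" "mat2 a b c d $ 1 $ 2 = b"
  "mat2 a b c d $ 2 $ 1 = c" "mat2 a b c d $ 2 $ 2 = d"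
  by (simp_all add: mat2_def)

lemma mat2_cases:
  obtains a b c d where "\<gamma> = mat2 a b c d"
  by (rule that[of "\<gamma>$1$1" "\<gamma>$1$2" "\<gamma>$2$1" "\<gamma>$2$2"]) (simp add: vec_eq_iff forall_2)

lemma mat2_mult:
  fixes a b c d :: "'a::comm_ring_1"
  shows "mat2 a b c d ** mat2 a' b' c' d' =
    mat2 (a * a' + b * c') (a * b' + b * d') (c * a' + d * c') (c * b' + d * d')"
  by (simp add: vec_eq_iff forall_2 matrix_matrix_mult_def sum_2)

lemma det_mat2:
  fixes a b c d :: "'a::comm_ring_1"
  shows "det (mat2 a b c d) = a * d - b * c"
  by (simp add: det_2)

lemma mat2_in_Gamma_full: "mat2 a b c d \<in> Gamma_full \<longleftrightarrow> (a * d - b * c) dvd 1"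
proof
  assume "mat2 a b c d \<in> Gamma_full"
  then obtain M where "mat2 a b c d ** M = mat 1"
    by (auto simp: Gamma_full_def invertible_def)
  then have "det (mat2 a b c d) * det M = 1" by (metis det_I det_mul)
  then show "(a * d - b * c) dvd 1" by (metis det_mat2 dvd_triv_left)
next
  assume "(a * d - b * c) dvd 1"
  then obtain v where v: "(a * d - b * c) * v = 1" by (metis dvdE)
  have one: "mat 1 = mat2 1 0 0 (1 :: 'a poly)"
    by (simp add: vec_eq_iff forall_2 mat_def)
  have "mat2 a b c d ** mat2 (d * v) (- b * v) (- c * v) (a * v) = mat 1"
    "mat2 (d * v) (- b * v) (- c * v) (a * v) ** mat2 a b c d = mat 1"
    using v by (simp_all add: one mat2_mult algebra_simps)
  then show "mat2 a b c d \<in> Gamma_full"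
    unfolding Gamma_full_def invertible_def by blast
qed

lemma mat2_in_Gamma0:
  "mat2 a b c d \<in> Gamma0 \<mm> \<longleftrightarrow> (a * d - b * c) dvd 1 \<and> \<mm> dvd c"
  by (simp add: Gamma0_def mat2_in_Gamma_full)

lemma mat2_in_Gamma1:
  "mat2 a b c d \<in> Gamma1 \<mm> \<longleftrightarrow> (a * d - b * c) dvd 1 \<and> \<mm> dvd c \<and> \<mm> dvd d - 1"
  by (simp add: Gamma1_def mat2_in_Gamma0)

text \<open>Row reduction over A: a Bezout relation for the first column gives a unimodular matrix
  sending it to the gcd and 0. It reduces growth questions for all nonsingular matrices to
  \<open>Gamma_full\<close>, where modular forms are controlled by definition.\<close>

lemma hermite_decomposition:
  fixes A B C D :: "'q::{finite_field,field_gcd} poly"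
  assumes "A * D - B * C \<noteq> 0"
  obtains \<gamma> a b d where "\<gamma> \<in> Gamma_full" "a \<noteq> 0" "d \<noteq> 0" "mat2 A B C D = \<gamma> ** mat2 a b 0 d"
proof -
  define a where "a = gcd A C"
  have "a \<noteq> 0" using assms by (auto simp: a_def)
  obtain A' C' where A': "A = a * A'" "C = a * C'"
    unfolding a_def by (meson dvdE gcd_dvd1 gcd_dvd2)
  obtain x y where "x * A + y * C = a"
    unfolding a_def by (metis bezout_coefficients_fst_snd)
  then have "a * (x * A' + y * C') = a * 1" using A' by (simp add: algebra_simps)
  then have xy: "x * A' + y * C' = 1" using \<open>a \<noteq> 0\<close> by simp
  \<comment> \<open>\<open>b\<close> and \<open>d\<close> are the second column after the row
    operation with rows (x, y) and (-C', A'), which has determinant 1.\<close>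
  define b where "b = x * B + y * D"
  define d where "d = A' * D - C' * B"
  have "A * D - B * C = a * d" by (simp add: A' d_def algebra_simps)
  then have "d \<noteq> 0" using assms by auto
  have "A' * b + (- y) * d = (x * A' + y * C') * B" "C' * b + x * d = (x * A' + y * C') * D"
    by (simp_all add: b_def d_def algebra_simps)
  then have "mat2 A B C D = mat2 A' (- y) C' x ** mat2 a b 0 d"
    unfolding mat2_mult xy by (simp add: A' mult.commute)
  moreover have "mat2 A' (- y) C' x \<in> Gamma_full"
    using xy by (simp add: mat2_in_Gamma_full mult.commute)
  ultimately show ?thesis using that \<open>a \<noteq> 0\<close> \<open>d \<noteq> 0\<close> by blast
qed

context C_infinity
begin

abbreviation toC :: "'q poly \<Rightarrow> 'c" where "toC \<equiv> A_to_C \<iota>"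

lemma A_to_C_zero [simp]: "toC 0 = 0"
  and A_to_C_one [simp]: "toC 1 = 1"
  and A_to_C_add: "toC (x + y) = toC x + toC y"
  and A_to_C_mult: "toC (x * y) = toC x * toC y"
  and A_to_C_eq_0_iff [simp]: "toC x = 0 \<longleftrightarrow> x = 0"
  by (simp_all add: A_to_C_def of_A_add K_to_C_add of_A_mult K_to_C_mult)

lemma slashA_mat2:
  "slashA \<iota> k m f (mat2 a b c d) z =
     toC (a * d - b * c) ^ m * inverse ((toC c * z + toC d) ^ k) * f ((toC a * z + toC b) / (toC c * z + toC d))"
  by (simp add: slashA_def slash_def map_matrix_def det_2 A_to_C_def of_A_diff of_A_mult Let_def)

text \<open>The cocycle relation for c z + d together with multiplicativity of the determinant;
  \<open>lin\<close> treats numerator and denominator of the composed transformation alike.\<close>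

lemma slashA_mult:
  assumes "toC c' * z + toC d' \<noteq> 0"
  shows "slashA \<iota> k m f (mat2 a b c d ** mat2 a' b' c' d') z =
    slashA \<iota> k m (slashA \<iota> k m f (mat2 a b c d)) (mat2 a' b' c' d') z"
proof -
  define j where "j = toC c' * z + toC d'"
  define w where "w = (toC a' * z + toC b') / j"
  have w: "toC a' * z + toC b' = w * j" using assms by (simp add: w_def j_def)
  have lin: "toC (x * a' + y * c') * z + toC (x * b' + y * d') = (toC x * w + toC y) * j" for x y
  proof -
    have "toC (x * a' + y * c') * z + toC (x * b' + y * d') = toC x * (toC a' * z + toC b') + toC y * j"
      by (simp add: A_to_C_add A_to_C_mult j_def algebra_simps)
    also have "\<dots> = (toC x * w + toC y) * j" by (simp only: w) (simp add: algebra_simps)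
    finally show ?thesis .
  qed
  have det: "(a * a' + b * c') * (c * b' + d * d') - (a * b' + b * d') * (c * a' + d * c') =
      (a * d - b * c) * (a' * d' - b' * c')"
    by (simp add: algebra_simps)
  show ?thesis
    unfolding mat2_mult slashA_mat2 lin det A_to_C_mult
    using assms unfolding j_def[symmetric] w_def[symmetric]
    by (simp add: power_mult_distrib)
qed

lemma linear_nonzero:
  assumes "z \<in> Omega \<iota>" "u \<noteq> 0 \<or> v \<noteq> 0"
  shows "K_to_C \<iota> u * z + K_to_C \<iota> v \<noteq> 0"
proof
  assume eq: "K_to_C \<iota> u * z + K_to_C \<iota> v = 0"
  show False
  proof (cases "u = 0")
    case False
    then have "z = K_to_C \<iota> (- v / u)"
      using eq by (simp add: K_to_C_divide K_to_C_minus field_simps eq_neg_iff_add_eq_0)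
    then show False using assms(1) by (auto simp: Omega_def)
  qed (use eq assms in auto)
qed

lemma denominator_nonzero:
  assumes "z \<in> Omega \<iota>" "a * d - b * c \<noteq> 0"
  shows "toC c * z + toC d \<noteq> 0"
  unfolding A_to_C_def using assms by (intro linear_nonzero) auto

text \<open>Subtracting \<open>x\<close> replaces the first row by itself minus \<open>x\<close>
  times the second, which preserves the determinant. Distances from the image point to Laurent
  series thereby become values of linear forms.\<close>

lemma moebius_minus:
  assumes "toC c * z + toC d \<noteq> 0"
  shows "(toC a * z + toC b) / (toC c * z + toC d) - K_to_C \<iota> x =
    (K_to_C \<iota> (of_A a - x * of_A c) * z + K_to_C \<iota> (of_A b - x * of_A d)) / (toC c * z + toC d)"
  using assms by (simp add: K_to_C_diff K_to_C_mult A_to_C_def divide_simps) (simp add: algebra_simps)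

lemma moebius_minus_det:
  "(of_A a - x * of_A c) * of_A d - (of_A b - x * of_A d) * of_A c = of_A (a * d - b * c)"
  by (simp add: of_A_diff of_A_mult algebra_simps)

lemma moebius_in_Omega:
  assumes "z \<in> Omega \<iota>" "a * d - b * c \<noteq> 0"
  shows "(toC a * z + toC b) / (toC c * z + toC d) \<in> Omega \<iota>"
proof -
  have j: "toC c * z + toC d \<noteq> 0" using assms by (rule denominator_nonzero)
  have "(toC a * z + toC b) / (toC c * z + toC d) \<noteq> K_to_C \<iota> x" for x
  proof -
    have "of_A a - x * of_A c \<noteq> 0 \<or> of_A b - x * of_A d \<noteq> 0"
      using moebius_minus_det[of a x c d b] assms(2) by force
    then have "(toC a * z + toC b) / (toC c * z + toC d) - K_to_C \<iota> x \<noteq> 0"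
      unfolding moebius_minus[OF j] using linear_nonzero[OF assms(1)] j by auto
    then show ?thesis by auto
  qed
  then show ?thesis by (auto simp: Omega_def)
qed

lemma slashA_cmult_cong:
  assumes "\<And>w. w \<in> Omega \<iota> \<Longrightarrow> f w = h * g w" "z \<in> Omega \<iota>" "a * d - b * c \<noteq> 0"
  shows "slashA \<iota> k m f (mat2 a b c d) z = h * slashA \<iota> k m g (mat2 a b c d) z"
  unfolding slashA_mat2 using assms(1)[OF moebius_in_Omega[OF assms(2,3)]] by simp

text \<open>For nonzero \<open>u\<close>, factoring it out leaves the distance from \<open>z\<close>
  to -v/u, at least \<open>\<epsilon>\<close>. This also controls \<open>v\<close> if its absolute
  value is at most \<open>R\<close> times that of \<open>u\<close>; otherwise \<open>v\<close>
  strictly dominates u z and determines the absolute value.\<close>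

lemma linear_lower_bound:
  assumes z: "nrm z \<le> R" "\<epsilon> \<le> im_abs \<iota> z" and \<epsilon>: "0 < \<epsilon>" "\<epsilon> \<le> 1" "1 \<le> R"
  shows "\<epsilon> / R * max (absK u) (absK v) \<le> nrm (K_to_C \<iota> u * z + K_to_C \<iota> v)"
proof -
  let ?n = "nrm (K_to_C \<iota> u * z + K_to_C \<iota> v)"
  have u: "absK u * \<epsilon> \<le> ?n"
  proof (cases "u = 0")
    case False
    have "\<epsilon> \<le> nrm (z - K_to_C \<iota> (- v / u))" using z(2) le_im_abs_iff by blast
    then have "absK u * \<epsilon> \<le> nrm (K_to_C \<iota> u * (z - K_to_C \<iota> (- v / u)))"
      unfolding abs_mult nrm_K_to_C[symmetric] by (intro mult_left_mono) auto
    then show ?thesis using False by (simp add: algebra_simps K_to_C_divide K_to_C_minus)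
  qed (simp add: absK_def)
  have nn: "absK u \<ge> 0" "absK v \<ge> 0" by (simp_all flip: nrm_K_to_C)
  have R: "\<epsilon> / R \<le> \<epsilon>" "\<epsilon> / R \<le> 1" using \<epsilon> by (simp_all add: field_simps)
  have "\<epsilon> / R * absK u \<le> ?n"
    using u mult_right_mono[OF R(1) nn(1)] by (simp add: mult.commute)
  moreover have "\<epsilon> / R * absK v \<le> ?n"
  proof (cases "absK v \<le> absK u * R")
    case True
    then have "\<epsilon> / R * absK v \<le> \<epsilon> / R * (absK u * R)" using \<epsilon> by (intro mult_left_mono) auto
    also have "\<dots> = absK u * \<epsilon>" using \<epsilon> by simp
    finally show ?thesis using u by simp
  next
    case False
    have "nrm (K_to_C \<iota> u * z) \<le> absK u * R"
      unfolding abs_mult nrm_K_to_C using z nn by (intro mult_left_mono) auto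
    then have "nrm (K_to_C \<iota> u * z) < nrm (K_to_C \<iota> v)" using False by (simp add: nrm_K_to_C)
    then have "?n = absK v" using nrm_add_eq by (metis add.commute nrm_K_to_C)
    then show ?thesis using mult_right_mono[OF R(2) nn(2)] by simp
  qed
  ultimately show ?thesis using \<epsilon> by (auto simp: max_def)
qed

text \<open>Upper and lower bounds for linear forms in \<open>z\<close> control the denominator and
  the modulus of the image. For the imaginary part, the shifted first row (u, v) satisfies u d - v c
  = det, so u and v cannot both be small.\<close>

lemma moebius_region:
  assumes det: "a * d - b * c \<noteq> 0" and \<epsilon>: "0 < \<epsilon>" "\<epsilon> \<le> 1" "1 \<le> R"
  shows "\<exists>R' \<epsilon>' \<delta>. \<epsilon>' > 0 \<and> \<delta> > 0 \<and> (\<forall>z. nrm z \<le> R \<longrightarrow> \<epsilon> \<le> im_abs \<iota> z \<longrightarrow>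
       \<delta> \<le> nrm (toC c * z + toC d) \<and> nrm ((toC a * z + toC b) / (toC c * z + toC d)) \<le> R' \<and>
       \<epsilon>' \<le> im_abs \<iota> ((toC a * z + toC b) / (toC c * z + toC d)))"
proof -
  define D where "D = max (absK (of_A c)) (absK (of_A d))"
  define B where "B = max (absK (of_A a)) (absK (of_A b))"
  have nn: "absK x \<ge> 0" for x :: "'q fls" by (simp flip: nrm_K_to_C)
  have absK_pos: "absK x > 0" if "x \<noteq> 0" for x :: "'q fls" using that by (simp flip: nrm_K_to_C)
  have "D > 0" using det absK_pos[of "of_A c"] absK_pos[of "of_A d"]
    by (cases "c = 0") (auto simp: D_def less_max_iff_disj)
  have upper: "nrm (toC x * z + toC y) \<le> R * max (absK (of_A x)) (absK (of_A y))" if "nrm z \<le> R" for x y z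
  proof (rule nrm_add_le)
    show "nrm (toC x * z) \<le> R * max (absK (of_A x)) (absK (of_A y))"
      unfolding abs_mult A_to_C_def nrm_K_to_C using that nn \<epsilon>
      by (subst mult.commute) (intro mult_mono, auto simp: le_max_iff_disj)
    show "nrm (toC y) \<le> R * max (absK (of_A x)) (absK (of_A y))"
      unfolding A_to_C_def nrm_K_to_C using nn \<epsilon> mult_mono[of 1 R "absK (of_A y)" "max (absK (of_A x)) (absK (of_A y))"]
      by auto
  qed
  define \<delta> where "\<delta> = \<epsilon> / R * D"
  have "\<delta> > 0" using \<open>D > 0\<close> \<epsilon> by (simp add: \<delta>_def)
  define E where "E = absK (of_A (a * d - b * c))"
  have "E > 0" using absK_pos det by (simp add: E_def)
  show ?thesis
  proof (intro exI conjI allI impI)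
    \<comment> \<open>\<open>E / D\<close> bounds the larger of u and v from below, the factor
      \<open>\<epsilon> / R\<close> carries this over to the value at \<open>z\<close>, and
      \<open>R * D\<close> bounds the denominator.\<close>
    show "(\<epsilon> / R * (E / D)) / (R * D) > 0" "\<delta> > 0"
      using \<open>E > 0\<close> \<open>D > 0\<close> \<epsilon> \<open>\<delta> > 0\<close> by simp_all
    fix z assume z: "nrm z \<le> R" "\<epsilon> \<le> im_abs \<iota> z"
    have zO: "z \<in> Omega \<iota>" using z \<epsilon> by (intro im_abs_pos_imp_Omega) simp
    have j: "toC c * z + toC d \<noteq> 0" using denominator_nonzero[OF zO det] .
    show lower: "\<delta> \<le> nrm (toC c * z + toC d)"
      unfolding \<delta>_def D_def A_to_C_def by (rule linear_lower_bound[OF z \<epsilon>])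
    show "nrm ((toC a * z + toC b) / (toC c * z + toC d)) \<le> R * B / \<delta>"
      unfolding nrm_divide B_def using upper[OF z(1)] lower \<open>\<delta> > 0\<close> nn \<epsilon>
      by (intro frac_le) (auto simp: le_max_iff_disj)
    show "(\<epsilon> / R * (E / D)) / (R * D) \<le> im_abs \<iota> ((toC a * z + toC b) / (toC c * z + toC d))"
      unfolding le_im_abs_iff moebius_minus[OF j] nrm_divide
    proof
      fix x
      define u where "u = of_A a - x * of_A c"
      define v where "v = of_A b - x * of_A d"
      have "E = nrm (K_to_C \<iota> (u * of_A d) - K_to_C \<iota> (v * of_A c))"
        unfolding E_def moebius_minus_det[of a x c d b, symmetric] u_def v_def
        by (simp add: K_to_C_diff flip: nrm_K_to_C)
      also have "\<dots> \<le> max (absK u) (absK v) * D"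
        unfolding D_def using nn
        by (intro nrm_diff_le) (auto simp: K_to_C_mult abs_mult nrm_K_to_C intro!: mult_mono simp: le_max_iff_disj)
      finally have "E / D \<le> max (absK u) (absK v)" using \<open>D > 0\<close> by (simp add: field_simps)
      then have "\<epsilon> / R * (E / D) \<le> \<epsilon> / R * max (absK u) (absK v)"
        using \<epsilon> by (intro mult_left_mono) auto
      also have "\<dots> \<le> nrm (K_to_C \<iota> u * z + K_to_C \<iota> v)" by (rule linear_lower_bound[OF z \<epsilon>])
      finally have "\<epsilon> / R * (E / D) \<le> nrm (K_to_C \<iota> u * z + K_to_C \<iota> v)" .
      moreover have "nrm (toC c * z + toC d) \<le> R * D" unfolding D_def by (rule upper[OF z(1)])
      ultimately show "\<epsilon> / R * (E / D) / (R * D)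
          \<le> nrm (K_to_C \<iota> (of_A a - x * of_A c) * z + K_to_C \<iota> (of_A b - x * of_A d)) / nrm (toC c * z + toC d)"
        unfolding u_def v_def using j by (intro frac_le) auto
    qed
  qed
qed

lemma slashA_bounded_region:
  assumes "rigid_analytic \<iota> f" "a * d - b * c \<noteq> 0" "0 < \<epsilon>" "\<epsilon> \<le> 1" "1 \<le> R"
  shows "\<exists>C. \<forall>z. nrm z \<le> R \<longrightarrow> \<epsilon> \<le> im_abs \<iota> z \<longrightarrow> nrm (slashA \<iota> k m f (mat2 a b c d) z) \<le> C"
proof -
  obtain R' \<epsilon>' \<delta> where r: "\<epsilon>' > 0" "\<delta> > 0"
    "\<And>z. nrm z \<le> R \<Longrightarrow> \<epsilon> \<le> im_abs \<iota> z \<Longrightarrow>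
       \<delta> \<le> nrm (toC c * z + toC d) \<and> nrm ((toC a * z + toC b) / (toC c * z + toC d)) \<le> R' \<and>
       \<epsilon>' \<le> im_abs \<iota> ((toC a * z + toC b) / (toC c * z + toC d))"
    using moebius_region[OF assms(2-)] by blast
  obtain n where n: "\<And>z. nrm z \<le> R' \<Longrightarrow> \<epsilon>' \<le> im_abs \<iota> z \<Longrightarrow> z \<in> Omega_aff \<iota> n"
    using region_subset_Omega_aff[OF r(1)] by blast
  obtain C where C: "\<And>z. z \<in> Omega_aff \<iota> n \<Longrightarrow> nrm (f z) \<le> C"
    using rigid_analytic_bounded[OF assms(1)] by blast
  define h where "h = nrm (toC (a * d - b * c) ^ m)"
  have "nrm (slashA \<iota> k m f (mat2 a b c d) z) \<le> h * inverse (\<delta> ^ k) * C"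
    if z: "nrm z \<le> R" "\<epsilon> \<le> im_abs \<iota> z" for z
  proof -
    let ?w = "(toC a * z + toC b) / (toC c * z + toC d)"
    have "nrm (inverse ((toC c * z + toC d) ^ k)) \<le> inverse (\<delta> ^ k)"
      unfolding nrm_inverse nrm_power using r(2) r(3)[OF z]
      by (intro le_imp_inverse_le power_mono) auto
    moreover have "nrm (f ?w) \<le> C" using C n r(3)[OF z] by blast
    ultimately show ?thesis
      unfolding slashA_mat2 abs_mult h_def by (intro mult_mono) (use r(2) in auto)
  qed
  then show ?thesis by blast
qed

text \<open>Conjugation in \<open>GL\<^sub>2(A)\<close> preserves congruence to the identity modulo
  \<open>\<mm>\<close>, so the conjugated translation stays in \<open>Gamma1 \<mm>\<close>, under
  which \<open>f\<close> is invariant.\<close>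

lemma slashA_Gamma1_periodic:
  assumes f: "f \<in> mod_forms \<iota> k m (Gamma1 \<mm>)" and det: "(a * d - b * c) dvd 1" and t: "\<mm> dvd t"
    and z: "z \<in> Omega \<iota>"
  shows "slashA \<iota> k m f (mat2 a b c d) (z + toC t) = slashA \<iota> k m f (mat2 a b c d) z"
proof -
  have nz: "a * d - b * c \<noteq> 0" using det by auto
  obtain v where v: "(a * d - b * c) * v = 1" using det by (metis dvdE)
  \<comment> \<open>the conjugate of the translation by \<open>t\<close>\<close>
  define \<sigma> where "\<sigma> = mat2 (1 - t * v * a * c) (t * v * a * a) (- t * v * c * c) (1 + t * v * a * c)"
  have "\<sigma> \<in> Gamma1 \<mm>"
    using t by (simp add: \<sigma>_def mat2_in_Gamma1 algebra_simps)
  then have inv: "slashA \<iota> k m f \<sigma> w = 1 * f w" if "w \<in> Omega \<iota>" for w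
    using f that by (auto simp: mod_forms_def)
  have "(1 - t * v * a * c) * b + t * v * a * a * d = b + a * t * ((a * d - b * c) * v)"
    "(- t * v * c * c) * b + (1 + t * v * a * c) * d = d + c * t * ((a * d - b * c) * v)"
    "(1 - t * v * a * c) * a + t * v * a * a * c = a"
    "(- t * v * c * c) * a + (1 + t * v * a * c) * c = c"
    by (simp_all add: algebra_simps)
  then have "mat2 a b c d ** mat2 1 t 0 1 = \<sigma> ** mat2 a b c d"
    unfolding \<sigma>_def mat2_mult v by (simp add: add.commute)
  then have "slashA \<iota> k m f (mat2 a b c d ** mat2 1 t 0 1) z = slashA \<iota> k m f (\<sigma> ** mat2 a b c d) z"
    by simp
  also have "\<dots> = slashA \<iota> k m (slashA \<iota> k m f \<sigma>) (mat2 a b c d) z"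
    unfolding \<sigma>_def by (intro slashA_mult denominator_nonzero[OF z nz])
  also have "\<dots> = slashA \<iota> k m f (mat2 a b c d) z"
    using slashA_cmult_cong[OF inv z nz] by simp
  also have "slashA \<iota> k m f (mat2 a b c d ** mat2 1 t 0 1) z = slashA \<iota> k m f (mat2 a b c d) (z + toC t)"
    by (subst slashA_mult) (simp_all add: slashA_mat2[of _ _ _ 1])
  finally show ?thesis .
qed

text \<open>The cusp condition covers imaginary absolute value at least 1. Below that,
  \<open>z\<close> is close to a Laurent series, and a period in the ideal of \<open>\<mm>\<close>
  moves it into a bounded region, where analyticity gives the bound.\<close>

lemma slashA_bounded_Gamma_full:
  assumes f: "f \<in> mod_forms \<iota> k m (Gamma1 \<mm>)" and m: "\<mm> \<noteq> 0" and g: "\<gamma> \<in> Gamma_full" and e: "0 < \<epsilon>"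
  shows "\<exists>C. \<forall>z. \<epsilon> \<le> im_abs \<iota> z \<longrightarrow> nrm (slashA \<iota> k m f \<gamma> z) \<le> C"
proof -
  obtain a b c d where \<gamma>: "\<gamma> = mat2 a b c d" by (rule mat2_cases)
  have det: "(a * d - b * c) dvd 1" using g by (simp add: \<gamma> mat2_in_Gamma_full)
  then have nz: "a * d - b * c \<noteq> 0" by auto
  have ra: "rigid_analytic \<iota> f" using f by (simp add: mod_forms_def)
  have "bounded (slashA \<iota> k m f \<gamma> ` {z \<in> Omega \<iota>. im_abs \<iota> z \<ge> 1})"
    using f g by (simp add: mod_forms_def)
  then obtain C1 where C1: "\<And>z. z \<in> Omega \<iota> \<Longrightarrow> im_abs \<iota> z \<ge> 1 \<Longrightarrow> nrm (slashA \<iota> k m f \<gamma> z) \<le> C1"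
    unfolding bounded_any_center[of _ 0] by (auto simp: dist_commute)
  define R where "R = max 1 (nrm (toC \<mm>))"
  define \<epsilon>' where "\<epsilon>' = min \<epsilon> 1"
  obtain C2 where C2: "\<And>z. nrm z \<le> R \<Longrightarrow> \<epsilon>' \<le> im_abs \<iota> z \<Longrightarrow> nrm (slashA \<iota> k m f \<gamma> z) \<le> C2"
    using slashA_bounded_region[OF ra nz, of \<epsilon>' R k m] e unfolding \<gamma> \<epsilon>'_def R_def by auto
  have "nrm (slashA \<iota> k m f \<gamma> z) \<le> max C1 C2" if z: "\<epsilon> \<le> im_abs \<iota> z" for z
  proof -
    have zO: "z \<in> Omega \<iota>" using z e by (intro im_abs_pos_imp_Omega) simp
    show ?thesis
    proof (cases "im_abs \<iota> z \<ge> 1")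
      case True
      then show ?thesis using C1[OF zO] by simp
    next
      case False
      then obtain x where x: "nrm (z - K_to_C \<iota> x) < 1" unfolding le_im_abs_iff not_all not_le by blast
      \<comment> \<open>With p the polynomial part of x / \<open>\<mm>\<close>, the remainder x -
        \<open>\<mm>\<close> p is no larger than \<open>\<mm>\<close>.\<close>
      obtain p where p: "absK (x / of_A \<mm> - of_A p) \<le> 1" using polynomial_part by blast
      define t where "t = \<mm> * p"
      have "K_to_C \<iota> x - toC t = toC \<mm> * K_to_C \<iota> (x / of_A \<mm> - of_A p)"
        using m by (simp add: t_def A_to_C_def of_A_mult K_to_C_diff K_to_C_mult K_to_C_divide algebra_simps)
      then have "nrm (K_to_C \<iota> x - toC t) \<le> nrm (toC \<mm>)"
        using p by (simp add: abs_mult nrm_K_to_C mult_left_le)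
      then have "nrm ((z - K_to_C \<iota> x) + (K_to_C \<iota> x - toC t)) \<le> R"
        using x unfolding R_def by (intro nrm_add_le) auto
      then have zt: "nrm (z - toC t) \<le> R" by simp
      have im: "im_abs \<iota> (z - toC t) = im_abs \<iota> z"
        using im_abs_translate[of z "- of_A t"] by (simp add: A_to_C_def K_to_C_minus)
      then have "z - toC t \<in> Omega \<iota>" using z e by (intro im_abs_pos_imp_Omega) simp
      then have "slashA \<iota> k m f \<gamma> z = slashA \<iota> k m f \<gamma> (z - toC t)"
        using slashA_Gamma1_periodic[OF f det, of t "z - toC t"] by (simp add: \<gamma> t_def)
      moreover have "nrm (slashA \<iota> k m f \<gamma> (z - toC t)) \<le> C2"
        using C2[OF zt] im z by (simp add: \<epsilon>'_def min.coboundedI1)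
      ultimately show ?thesis by simp
    qed
  qed
  then show ?thesis by blast
qed

text \<open>The triangular factor of the Hermite decomposition has a constant automorphy factor and
  scales the imaginary absolute value by that of a/d, so the bound for \<open>\<gamma>\<close> is
  used with a rescaled \<open>\<epsilon>\<close>.\<close>

lemma slashA_bounded:
  assumes f: "f \<in> mod_forms \<iota> k m (Gamma1 \<mm>)" and m: "\<mm> \<noteq> 0" and det: "A * D - B * C \<noteq> 0" and e: "0 < \<epsilon>"
  shows "\<exists>b. \<forall>z. \<epsilon> \<le> im_abs \<iota> z \<longrightarrow> nrm (slashA \<iota> k m f (mat2 A B C D) z) \<le> b"
proof -
  obtain \<gamma> a b d where \<gamma>: "\<gamma> \<in> Gamma_full" "a \<noteq> 0" "d \<noteq> 0" "mat2 A B C D = \<gamma> ** mat2 a b 0 d"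
    using hermite_decomposition[OF det] by metis
  define \<epsilon>' where "\<epsilon>' = nrm (toC a / toC d) * \<epsilon>"
  have "\<epsilon>' > 0" using \<gamma> e by (simp add: \<epsilon>'_def)
  then obtain h where h: "\<And>z. \<epsilon>' \<le> im_abs \<iota> z \<Longrightarrow> nrm (slashA \<iota> k m f \<gamma> z) \<le> h"
    using slashA_bounded_Gamma_full[OF f m \<gamma>(1)] by blast
  have "nrm (slashA \<iota> k m f (mat2 A B C D) z) \<le> nrm (toC (a * d) ^ m * inverse (toC d ^ k)) * h"
    if z: "\<epsilon> \<le> im_abs \<iota> z" for z
  proof -
    let ?w = "(toC a * z + toC b) / toC d"
    have "\<epsilon>' \<le> im_abs \<iota> ?w"
      unfolding le_im_abs_iff
    proof
      fix x
      \<comment> \<open>\<open>y\<close> is the preimage of \<open>x\<close> under the affine map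
        given by the triangular matrix.\<close>
      define y where "y = (of_A d * x - of_A b) / of_A a"
      have eq: "?w - K_to_C \<iota> x = (toC a / toC d) * (z - K_to_C \<iota> y)"
        using \<gamma>(2,3) by (simp add: y_def K_to_C_divide K_to_C_diff K_to_C_mult A_to_C_def field_simps)
      have "\<epsilon> \<le> nrm (z - K_to_C \<iota> y)" using z le_im_abs_iff by blast
      then show "\<epsilon>' \<le> nrm (?w - K_to_C \<iota> x)"
        unfolding eq abs_mult \<epsilon>'_def by (intro mult_left_mono) auto
    qed
    then have "nrm (slashA \<iota> k m f \<gamma> ?w) \<le> h" by (rule h)
    moreover have "slashA \<iota> k m f (mat2 A B C D) z =
        toC (a * d) ^ m * inverse (toC d ^ k) * slashA \<iota> k m f \<gamma> ?w"
    proof -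
      obtain a' b' c' d' where \<gamma>': "\<gamma> = mat2 a' b' c' d'" by (rule mat2_cases)
      show ?thesis
        unfolding \<gamma>(4) unfolding \<gamma>' using \<gamma>(3) by (subst slashA_mult) (simp_all add: slashA_mat2[of _ _ _ a])
    qed
    ultimately show ?thesis by (simp add: abs_mult mult_left_mono)
  qed
  then show ?thesis by blast
qed

end

section \<open>Characters\<close>

lemma absA_less_iff:
  fixes b n :: "'q::{finite_field,field_gcd} poly"
  assumes "n \<noteq> 0"
  shows "absA b < absA n \<longleftrightarrow> b = 0 \<or> Polynomial.degree b < Polynomial.degree n"
  using assms CARD_gt_1[where 'q = 'q] by (auto simp: absA_def)

text \<open>Residues correspond to coefficient lists of length deg n, padded by zeros; the fixed
  length makes \<open>Poly\<close> injective.\<close>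

lemma card_residues:
  fixes n :: "'q::{finite_field,field_gcd} poly"
  assumes "n \<noteq> 0"
  shows "finite {b :: 'q poly. absA b < absA n}" "card {b :: 'q poly. absA b < absA n} = absA n"
proof -
  let ?d = "Polynomial.degree n"
  let ?L = "{xs :: 'q list. set xs \<subseteq> UNIV \<and> length xs = ?d}"
  have inj: "inj_on Poly ?L"
  proof (rule inj_onI)
    fix xs ys :: "'q list" assume *: "xs \<in> ?L" "ys \<in> ?L" "Poly xs = Poly ys"
    have "xs ! i = ys ! i" if "i < ?d" for i
    proof -
      have "nth_default 0 xs i = nth_default 0 ys i" using *(3) by (metis coeff_Poly_eq)
      then show ?thesis using * that by (simp add: nth_default_def)
    qed
    then show "xs = ys" using * by (intro nth_equalityI) auto
  qed
  have img: "Poly ` ?L = {b :: 'q poly. absA b < absA n}"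
  proof (intro equalityI subsetI)
    fix b assume "b \<in> Poly ` ?L"
    then obtain xs where xs: "b = Poly xs" "length xs = ?d" by auto
    have "Polynomial.degree b < ?d" if "b \<noteq> 0"
    proof (rule ccontr)
      assume "\<not> ?thesis"
      then have "Polynomial.lead_coeff b = 0" using xs by (simp add: nth_default_def)
      then show False using that by simp
    qed
    then show "b \<in> {b :: 'q poly. absA b < absA n}" using assms by (auto simp: absA_less_iff)
  next
    fix b assume "b \<in> {b :: 'q poly. absA b < absA n}"
    then have "b = 0 \<or> Polynomial.degree b < ?d" using assms by (simp add: absA_less_iff)
    then have z: "poly.coeff b i = 0" if "i \<ge> ?d" for i using that by (auto intro: coeff_eq_0)
    have "b = Poly (map (poly.coeff b) [0..<?d])"
      by (rule poly_eqI) (auto simp: nth_default_def z)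
    then show "b \<in> Poly ` ?L" by (intro image_eqI) auto
  qed
  have "card ?L = absA n" using assms by (subst card_lists_length_eq) (simp_all add: absA_def)
  then show "card {b :: 'q poly. absA b < absA n} = absA n"
    using card_image[OF inj] by (simp only: img)
  have "finite ?L" by (rule finite_lists_length_eq) simp
  then show "finite {b :: 'q poly. absA b < absA n}"
    unfolding img[symmetric] by (rule finite_imageI)
qed

lemma residue_mod:
  fixes n :: "'q::{finite_field,field_gcd} poly"
  assumes "n \<noteq> 0"
  shows "absA (x mod n) < absA n" and "absA x < absA n \<Longrightarrow> x mod n = x"
  using degree_mod_less[OF assms, of x] mod_poly_less[of x n] assms by (auto simp: absA_less_iff)

lemma bij_betw_residues:
  fixes n u :: "'q::{finite_field,field_gcd} poly"
  assumes n: "n \<noteq> 0" and u: "coprime u n"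
  shows "bij_betw (\<lambda>b. (u * b) mod n) {b :: 'q poly. absA b < absA n} {b :: 'q poly. absA b < absA n}"
proof -
  have "inj_on (\<lambda>b. (u * b) mod n) {b :: 'q poly. absA b < absA n}"
  proof (rule inj_onI)
    fix x y assume xy: "x \<in> {b :: 'q poly. absA b < absA n}" "y \<in> {b :: 'q poly. absA b < absA n}"
      and "(u * x) mod n = (u * y) mod n"
    then have "n dvd u * (x - y)" by (simp add: mod_eq_dvd_iff right_diff_distrib)
    then have "n dvd x - y" using u by (simp add: coprime_dvd_mult_right_iff coprime_commute)
    then have "x mod n = y mod n" by (simp add: mod_eq_dvd_iff)
    then show "x = y" using xy residue_mod(2)[OF n] by simp
  qed
  then show ?thesis
    unfolding bij_betw_def using residue_mod(1)[OF n]
    by (intro conjI endo_inj_surj card_residues[OF n]) auto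
qed

lemma sum_residues_mult:
  fixes n u :: "'q::{finite_field,field_gcd} poly"
  assumes n: "n \<noteq> 0" and u: "coprime u n" and F: "\<And>x y. n dvd x - y \<Longrightarrow> F x = F y"
  shows "(\<Sum>b | absA b < absA n. F (u * b)) = (\<Sum>b | absA b < absA n. F b)"
proof -
  have "F (u * b) = F ((u * b) mod n)" for b
    by (rule F) (metis dvd_minus_mod)
  then show ?thesis
    using sum.reindex_bij_betw[OF bij_betw_residues[OF n u], of F] by simp
qed

context C_infinity
begin

section \<open>Evaluation at roots and values of characters\<close>

lemma evalA_add: "evalA \<iota> (a + b) x = evalA \<iota> a x + evalA \<iota> b x"
  and evalA_mult: "evalA \<iota> (a * b) x = evalA \<iota> a x * evalA \<iota> b x"
  unfolding evalA_def
  by (subst poly_map_poly_add poly_map_poly_mult;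
      simp add: fls_plus_const fls_const_mult_const flip: K_to_C_add K_to_C_mult)+

lemma evalA_const: "evalA \<iota> [:c:] x = toC [:c:]"
  by (simp add: evalA_def A_to_C_def of_A_pCons map_poly_pCons)

lemma evalA_one [simp]: "evalA \<iota> 1 x = 1"
  using evalA_const[of 1] by (simp add: one_pCons[symmetric])

lemma evalA_cong:
  assumes "evalA \<iota> p x = 0" "p dvd a - b"
  shows "evalA \<iota> a x = evalA \<iota> b x"
proof -
  obtain h where "a = b + p * h" using assms(2) by (metis add_diff_cancel_left' diff_add_cancel dvdE add.commute)
  then show ?thesis using assms(1) by (simp add: evalA_add evalA_mult)
qed

lemma evalA_nonzero:
  assumes "evalA \<iota> p x = 0" "coprime a p"
  shows "evalA \<iota> a x \<noteq> 0"
proof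
  assume a0: "evalA \<iota> a x = 0"
  obtain u v where "u * a + v * p = 1"
    using assms(2) by (metis bezout_coefficients_fst_snd coprime_imp_gcd_eq_1)
  then have "evalA \<iota> (u * a + v * p) x = 1" by simp
  then show False using a0 assms(1) by (simp add: evalA_add evalA_mult)
qed

text \<open>Fermat's argument: multiplication by \<open>u\<close> permutes the nonzero residues
  modulo \<open>p\<close>, so the product of their values at the root is unchanged by the factor on
  the left. That product is nonzero because nonzero residues are coprime to
  \<open>p\<close>.\<close>

lemma evalA_fermat:
  assumes p: "Factorial_Ring.prime p" and x: "evalA \<iota> p x = 0" and u: "coprime u p"
  shows "evalA \<iota> u x ^ (absA p - 1) = 1"
proof -
  have p0: "p \<noteq> 0" using p by auto
  let ?S = "{b :: 'q poly. absA b < absA p}"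
  have dvd: "b = 0" if "b \<in> ?S" "p dvd b" for b
    using that residue_mod(2)[OF p0, of b] by (simp add: mod_eq_0_iff_dvd)
  have S0: "0 \<in> ?S" using p0 by (simp add: absA_less_iff)
  have "bij_betw (\<lambda>b. (u * b) mod p) (?S - {0}) (?S - {0})"
    using bij_betw_DiffI[OF bij_betw_residues[OF p0 u], of "{0}" "{0}"] S0 by auto
  then have "(\<Prod>b\<in>?S - {0}. evalA \<iota> b x) = (\<Prod>b\<in>?S - {0}. evalA \<iota> ((u * b) mod p) x)"
    by (simp add: prod.reindex_bij_betw[of _ _ _ "\<lambda>b. evalA \<iota> b x"])
  also have "\<dots> = (\<Prod>b\<in>?S - {0}. evalA \<iota> u x * evalA \<iota> b x)"
    unfolding evalA_mult[symmetric]
    by (intro prod.cong refl evalA_cong[OF x]) (metis dvd_minus_mod dvd_diff_commute)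
  also have "\<dots> = evalA \<iota> u x ^ (absA p - 1) * (\<Prod>b\<in>?S - {0}. evalA \<iota> b x)"
  proof -
    have "card (?S - {0}) = absA p - 1"
      using card_residues(2)[OF p0] S0 by (subst card_Diff_singleton) auto
    then show ?thesis by (simp add: prod.distrib)
  qed
  finally have "1 * (\<Prod>b\<in>?S - {0}. evalA \<iota> b x) =
      evalA \<iota> u x ^ (absA p - 1) * (\<Prod>b\<in>?S - {0}. evalA \<iota> b x)" by simp
  moreover have "(\<Prod>b\<in>?S - {0}. evalA \<iota> b x) \<noteq> 0"
  proof -
    have "evalA \<iota> b x \<noteq> 0" if b: "b \<in> ?S - {0}" for b
    proof (rule evalA_nonzero[OF x])
      have "\<not> p dvd b" using dvd b by blast
      then show "coprime b p" using prime_imp_coprime[OF p] by (metis coprime_commute)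
    qed
    then show ?thesis using card_residues[OF p0] by (subst prod_zero_iff) auto
  qed
  ultimately show ?thesis by (metis mult_right_cancel)
qed

lemma char_of_exps_mult:
  "char_of_exps \<iota> n \<xi> e (a * b) = char_of_exps \<iota> n \<xi> e a * char_of_exps \<iota> n \<xi> e b"
  by (simp add: char_of_exps_def evalA_mult power_mult_distrib prod.distrib)

lemma char_of_exps_one [simp]: "char_of_exps \<iota> n \<xi> e 1 = 1"
  by (simp add: char_of_exps_def)

text \<open>Congruence is asked only modulo each prime factor, i.e. modulo the radical: this is all
  that is known about the lower right entry in \<open>slashA_translation_Gamma0\<close>.\<close>

lemma char_of_exps_cong:
  assumes "root_choice \<iota> n \<xi>" "\<And>p. p \<in> prime_factors n \<Longrightarrow> p dvd a - b"
  shows "char_of_exps \<iota> n \<xi> e a = char_of_exps \<iota> n \<xi> e b"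
  unfolding char_of_exps_def
proof (rule prod.cong)
  fix p assume p: "p \<in> prime_factors n"
  then have "evalA \<iota> p (\<xi> p) = 0" using assms(1) by (simp add: root_choice_def)
  then show "evalA \<iota> a (\<xi> p) ^ e p = evalA \<iota> b (\<xi> p) ^ e p"
    using evalA_cong assms(2)[OF p] by metis
qed simp

text \<open>At each prime the two exponents add up to a multiple of \<open>absA p - 1\<close>, which
  \<open>evalA_fermat\<close> kills.\<close>

lemma char_of_exps_inverse:
  assumes root: "root_choice \<iota> n \<xi>" and e: "e \<in> char_exps n" and u: "coprime u n"
  shows "char_of_exps \<iota> n \<xi> e u * char_of_exps \<iota> n \<xi> (inv_exps e) u = 1"
  unfolding char_of_exps_def prod.distrib[symmetric]
proof (rule prod.neutral, rule ballI)
  fix p assume p: "p \<in> prime_factors n"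
  let ?N = "absA p - 1"
  have N: "e p < ?N" using e p by (simp add: char_exps_def)
  have "int (e p + inv_exps e p) mod int ?N = (int (e p) + (- int (e p) mod int ?N)) mod int ?N"
    using N by (simp add: inv_exps_def)
  also have "\<dots> = 0" by (simp add: mod_add_right_eq)
  finally have "int ?N dvd int (e p + inv_exps e p)" by (simp only: mod_eq_0_iff_dvd)
  then have "?N dvd e p + inv_exps e p" by (simp only: int_dvd_int_iff)
  then obtain j where j: "e p + inv_exps e p = ?N * j" by (rule dvdE)
  have "p dvd n" "Factorial_Ring.prime p" using p by (auto simp: in_prime_factors_iff)
  moreover have "coprime u p" using u \<open>p dvd n\<close> by (meson coprime_divisors dvd_refl)
  moreover have "evalA \<iota> p (\<xi> p) = 0" using root p by (simp add: root_choice_def)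
  ultimately have "evalA \<iota> u (\<xi> p) ^ ?N = 1" using evalA_fermat by blast
  then show "evalA \<iota> u (\<xi> p) ^ e p * evalA \<iota> u (\<xi> p) ^ inv_exps e p = 1"
    unfolding power_add[symmetric] j power_mult by simp
qed

text \<open>Units are constants, equal to their value at every root, and satisfy
  \<open>c ^ (q - 1) = 1\<close>; only the exponent sum modulo q - 1 survives. This is where the
  change of type comes from.\<close>

lemma char_of_exps_unit:
  fixes \<delta> :: "'q poly"
  assumes "\<delta> dvd 1"
  shows "char_of_exps \<iota> n \<xi> e \<delta> = toC \<delta> ^ char_sign n e"
proof -
  obtain c where c: "\<delta> = [:c:]" "c \<noteq> 0" using assms unfolding is_unit_poly_iff by (metis not_is_unit_0)
  have card: "CARD('q) = Suc (CARD('q) - 1)" using CARD_gt_1[where 'q = 'q] by simp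
  have "c * c ^ (CARD('q) - 1) = c * 1"
    using finite_field_power_card_eq_same[of c] card by (metis mult.right_neutral power_Suc)
  then have c1: "c ^ (CARD('q) - 1) = 1" using c by simp
  have "toC ([:c:] ^ j) = toC [:c:] ^ j" for j by (induction j) (simp_all only: power_0 power_Suc A_to_C_one A_to_C_mult)
  then have "toC [:c:] ^ (CARD('q) - 1) = toC [:c ^ (CARD('q) - 1):]" by (metis poly_const_pow)
  then have one: "toC \<delta> ^ (CARD('q) - 1) = 1" using c1 c by (simp add: one_pCons[symmetric])
  have "char_of_exps \<iota> n \<xi> e \<delta> = toC \<delta> ^ (\<Sum>p\<in>prime_factors n. e p)"
    by (simp add: char_of_exps_def c evalA_const power_sum)
  also have "\<dots> = toC \<delta> ^ ((CARD('q) - 1) * ((\<Sum>p\<in>prime_factors n. e p) div (CARD('q) - 1)) + char_sign n e)"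
    by (simp add: char_sign_def)
  also have "\<dots> = toC \<delta> ^ char_sign n e" by (simp only: power_add power_mult one power_one mult_1)
  finally show ?thesis .
qed

end

section \<open>The projection and its Hecke eigenvalues\<close>

context C_infinity
begin

lemma slashA_sum:
  "slashA \<iota> k m (\<lambda>w. \<Sum>i\<in>I. h i * f i w) (mat2 a b c d) z = (\<Sum>i\<in>I. h i * slashA \<iota> k m (f i) (mat2 a b c d) z)"
  by (simp add: slashA_mat2 sum_distrib_left mult_ac)

lemma slashA_type_add:
  "slashA \<iota> k (m + s) f (mat2 a b c d) z = toC (a * d - b * c) ^ s * slashA \<iota> k m f (mat2 a b c d) z"
  by (simp add: slashA_mat2 power_add mult_ac)

text \<open>Conjugating the matrix by the two translations gives upper right entry B +
  (\<open>\<beta>\<close> D - \<open>\<beta>'\<close> A)/\<open>\<nn>\<close> -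
  \<open>\<beta>\<close> \<open>\<beta>'\<close> C/\<open>\<nn>\<^sup>2\<close>. It is integral by
  the congruence and by \<open>\<nn>\<^sup>2\<close> dividing C, which explains the square in the
  level.\<close>

lemma slashA_translation_Gamma0:
  assumes root: "root_choice \<iota> \<mm> \<zeta>" and \<psi>: "\<psi> \<in> characters \<iota> \<mm> \<zeta>"
    and f: "f \<in> mod_forms_char \<iota> k m \<mm> \<psi>" and n: "\<nn> \<noteq> 0"
    and det: "(A * D - B * C) dvd 1" and C: "lcm \<mm> (\<nn>\<^sup>2) dvd C"
    and \<beta>': "\<nn> dvd \<beta> * D - \<beta>' * A" and z: "z \<in> Omega \<iota>"
  shows "slashA \<iota> k m f (mat2 \<nn> \<beta> 0 \<nn> ** mat2 A B C D) z = \<psi> D * slashA \<iota> k m f (mat2 \<nn> \<beta>' 0 \<nn>) z"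
proof -
  have "\<nn>\<^sup>2 dvd C" "\<mm> dvd C" using C by (meson dvd_lcm1 dvd_lcm2 dvd_trans)+
  then obtain C' where C': "C = \<nn> * \<nn> * C'" by (auto simp: power2_eq_square)
  obtain w where w: "\<beta> * D - \<beta>' * A = \<nn> * w" using \<beta>' by (rule dvdE)
  define \<gamma> where "\<gamma> = mat2 (A + \<beta> * \<nn> * C') (B + w - \<beta> * \<beta>' * C') C (D - \<nn> * C' * \<beta>')"
  have "(A + \<beta> * \<nn> * C') * \<beta>' + (B + w - \<beta> * \<beta>' * C') * \<nn> = \<nn> * B + (\<nn> * w + \<beta>' * A)"
    by (simp add: algebra_simps)
  also have "\<dots> = \<nn> * B + \<beta> * D" unfolding w[symmetric] by simp
  finally have "mat2 \<nn> \<beta> 0 \<nn> ** mat2 A B C D = \<gamma> ** mat2 \<nn> \<beta>' 0 \<nn>"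
    unfolding \<gamma>_def mat2_mult by (simp only:) (simp add: C' algebra_simps)
  then have "slashA \<iota> k m f (mat2 \<nn> \<beta> 0 \<nn> ** mat2 A B C D) z = slashA \<iota> k m (slashA \<iota> k m f \<gamma>) (mat2 \<nn> \<beta>' 0 \<nn>) z"
    using n unfolding \<gamma>_def by (simp add: slashA_mult)
  moreover have "slashA \<iota> k m f \<gamma> v = \<psi> D * f v" if "v \<in> Omega \<iota>" for v
  proof -
    have "(A + \<beta> * \<nn> * C') * (D - \<nn> * C' * \<beta>') - (B + w - \<beta> * \<beta>' * C') * C =
        A * D - B * C + \<nn> * C' * (\<beta> * D - \<beta>' * A - \<nn> * w)"
      by (simp add: C' algebra_simps)
    then have "(A + \<beta> * \<nn> * C') * (D - \<nn> * C' * \<beta>') - (B + w - \<beta> * \<beta>' * C') * C = A * D - B * C"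
      by (simp add: w)
    then have "\<gamma> \<in> Gamma0 \<mm>" using det \<open>\<mm> dvd C\<close> by (simp add: \<gamma>_def mat2_in_Gamma0)
    then have "slashA \<iota> k m f \<gamma> v = \<psi> (D - \<nn> * C' * \<beta>') * f v"
      using f that by (auto simp: mod_forms_char_def \<gamma>_def)
    moreover have "\<psi> (D - \<nn> * C' * \<beta>') = \<psi> D"
    proof -
      obtain e where e: "\<psi> = char_of_exps \<iota> \<mm> \<zeta> e" using \<psi> by (auto simp: characters_def)
      show ?thesis unfolding e
      proof (rule char_of_exps_cong[OF root])
        fix p assume p: "p \<in> prime_factors \<mm>"
        have "p dvd \<nn> * (\<nn> * C')"
          using p \<open>\<mm> dvd C\<close> C' by (metis dvd_trans in_prime_factors_imp_dvd mult.assoc)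
        \<comment> \<open>A prime dividing \<open>\<nn>\<close> * (\<open>\<nn>\<close> * C')
          divides one of the two factors, and in either case the second one.\<close>
        then have "p dvd \<nn> * C'"
          using in_prime_factors_imp_prime[OF p] by (auto simp: prime_dvd_mult_iff)
        then show "p dvd D - \<nn> * C' * \<beta>' - D" by simp
      qed
    qed
    ultimately show ?thesis by simp
  qed
  ultimately show ?thesis using slashA_cmult_cong[OF _ z] n by simp
qed

text \<open>The case of the identity matrix: the summands depend only on the class of
  \<open>\<beta>\<close>, as any reindexing of the projection requires.\<close>

lemma slashA_translation_cong:
  assumes "root_choice \<iota> \<mm> \<zeta>" "\<psi> \<in> characters \<iota> \<mm> \<zeta>" "f \<in> mod_forms_char \<iota> k m \<mm> \<psi>" "\<nn> \<noteq> 0"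
    "\<nn> dvd \<beta> - \<beta>'" "z \<in> Omega \<iota>"
  shows "slashA \<iota> k m f (mat2 \<nn> \<beta> 0 \<nn>) z = slashA \<iota> k m f (mat2 \<nn> \<beta>' 0 \<nn>) z"
proof -
  have "\<psi> 1 = 1" using assms(2) by (auto simp: characters_def)
  then show ?thesis
    using slashA_translation_Gamma0[OF assms(1-4), of 1 1 0 0 \<beta> \<beta>' z] assms(5,6)
    by (simp add: mat2_mult)
qed

lemma slashA_char_proj:
  assumes "z \<in> Omega \<iota>" "a * d - b * c \<noteq> 0"
  shows "slashA \<iota> k m (char_proj \<iota> k m \<nn> \<xi> e f) (mat2 a b c d) z =
    (\<Sum>\<beta> | absA \<beta> < absA \<nn>. char_of_exps \<iota> \<nn> \<xi> (inv_exps e) \<beta> *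
        slashA \<iota> k m f (mat2 \<nn> \<beta> 0 \<nn> ** mat2 a b c d) z)"
proof -
  have "char_proj \<iota> k m \<nn> \<xi> e f = (\<lambda>z. \<Sum>\<beta> | absA \<beta> < absA \<nn>.
      char_of_exps \<iota> \<nn> \<xi> (inv_exps e) \<beta> * slashA \<iota> k m f (mat2 \<nn> \<beta> 0 \<nn>) z)"
    by (rule ext) (simp add: char_proj_def)
  then show ?thesis
    using denominator_nonzero[OF assms] by (simp add: slashA_sum slashA_mult)
qed

text \<open>As \<open>\<chi>(u) \<chi>\<^sup>-\<^sup>1(u) = 1\<close>, the weight at
  \<open>\<beta>\<close> is \<open>\<chi>(u)\<close> times the weight at u \<open>\<beta>\<close>,
  and u \<open>\<beta>\<close> runs over all residues again.\<close>

lemma char_proj_reindex: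
  assumes root: "root_choice \<iota> \<nn> \<xi>" and e: "e \<in> char_exps \<nn>" and n: "\<nn> \<noteq> 0" and u: "coprime u \<nn>"
    and F: "\<And>x y. \<nn> dvd x - y \<Longrightarrow> F x = F y"
  shows "(\<Sum>\<beta> | absA \<beta> < absA \<nn>. char_of_exps \<iota> \<nn> \<xi> (inv_exps e) \<beta> * F (u * \<beta>)) =
    char_of_exps \<iota> \<nn> \<xi> e u * (\<Sum>\<beta> | absA \<beta> < absA \<nn>. char_of_exps \<iota> \<nn> \<xi> (inv_exps e) \<beta> * F \<beta>)"
proof -
  let ?c = "char_of_exps \<iota> \<nn> \<xi> e" and ?i = "char_of_exps \<iota> \<nn> \<xi> (inv_exps e)"
  have "?i \<beta> = ?c u * ?i (u * \<beta>)" for \<beta>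
    using char_of_exps_inverse[OF root e u] by (simp add: char_of_exps_mult flip: mult.assoc)
  then have i: "?i \<beta> * h = ?c u * (?i (u * \<beta>) * h)" for \<beta> h by (metis mult.assoc)
  have "(\<Sum>\<beta> | absA \<beta> < absA \<nn>. ?i \<beta> * F (u * \<beta>)) =
      ?c u * (\<Sum>\<beta> | absA \<beta> < absA \<nn>. ?i (u * \<beta>) * F (u * \<beta>))"
    unfolding sum_distrib_left by (intro sum.cong refl i)
  also have "(\<Sum>\<beta> | absA \<beta> < absA \<nn>. ?i (u * \<beta>) * F (u * \<beta>)) = (\<Sum>\<beta> | absA \<beta> < absA \<nn>. ?i \<beta> * F \<beta>)"
  proof (rule sum_residues_mult[OF n u])
    fix x y assume xy: "\<nn> dvd x - y"
    have "?i x = ?i y"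
      by (rule char_of_exps_cong[OF root]) (use xy in \<open>auto dest!: in_prime_factors_imp_dvd intro: dvd_trans\<close>)
    then show "?i x * F x = ?i y * F y" using F[OF xy] by simp
  qed
  finally show ?thesis .
qed

text \<open>Each summand is a constant multiple of a translate of \<open>f\<close> by
  \<open>\<beta>\<close> / \<open>\<nn>\<close>.\<close>

lemma char_proj_rigid_analytic:
  assumes "rigid_analytic \<iota> f" "\<nn> \<noteq> 0"
  shows "rigid_analytic \<iota> (char_proj \<iota> k m \<nn> \<xi> e f)"
proof -
  have "(\<lambda>z. slashA \<iota> k m f (mat2 \<nn> \<beta> 0 \<nn>) z) =
     (\<lambda>z. toC (\<nn> * \<nn>) ^ m * inverse (toC \<nn> ^ k) * f (z + K_to_C \<iota> (of_A \<beta> / of_A \<nn>)))" for \<beta>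
    using assms(2)
    by (simp add: slashA_mat2 K_to_C_divide flip: A_to_C_def) (simp add: add_divide_distrib)
  then have "rigid_analytic \<iota> (\<lambda>z. slashA \<iota> k m f (mat2 \<nn> \<beta> 0 \<nn>) z)" for \<beta>
    by (simp only:) (intro rigid_analytic_cmult rigid_analytic_translate assms)
  then have "rigid_analytic \<iota> (\<lambda>z. \<Sum>\<beta> | absA \<beta> < absA \<nn>.
      char_of_exps \<iota> \<nn> \<xi> (inv_exps e) \<beta> * slashA \<iota> k m f (mat2 \<nn> \<beta> 0 \<nn>) z)"
    by (intro rigid_analytic_sum rigid_analytic_cmult)
  then show ?thesis unfolding char_proj_def[abs_def] .
qed

lemma char_proj_bounded:
  assumes f: "f \<in> mod_forms \<iota> k m (Gamma1 \<mm>)" and m: "\<mm> \<noteq> 0" and n: "\<nn> \<noteq> 0" and g: "\<gamma> \<in> Gamma_full"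
  shows "bounded (slashA \<iota> k (m + s) (char_proj \<iota> k m \<nn> \<xi> e f) \<gamma> ` {z \<in> Omega \<iota>. im_abs \<iota> z \<ge> 1})"
proof -
  obtain a b c d where \<gamma>: "\<gamma> = mat2 a b c d" by (rule mat2_cases)
  have nz: "a * d - b * c \<noteq> 0" using g by (auto simp: \<gamma> mat2_in_Gamma_full)
  let ?i = "char_of_exps \<iota> \<nn> \<xi> (inv_exps e)"
  have "\<exists>h. \<forall>z. 1 \<le> im_abs \<iota> z \<longrightarrow> nrm (slashA \<iota> k m f (mat2 \<nn> \<beta> 0 \<nn> ** mat2 a b c d) z) \<le> h" for \<beta>
  proof -
    have "(\<nn> * a + \<beta> * c) * (\<nn> * d) - (\<nn> * b + \<beta> * d) * (\<nn> * c) = \<nn> * \<nn> * (a * d - b * c)"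
      by (simp add: algebra_simps)
    then have "(\<nn> * a + \<beta> * c) * (\<nn> * d) - (\<nn> * b + \<beta> * d) * (\<nn> * c) \<noteq> 0" using n nz by simp
    then show ?thesis using slashA_bounded[OF f m, of "\<nn> * a + \<beta> * c" "\<nn> * d" "\<nn> * b + \<beta> * d" "\<nn> * c" 1]
      by (simp add: mat2_mult)
  qed
  then obtain h where h: "\<And>\<beta> z. 1 \<le> im_abs \<iota> z \<Longrightarrow>
      nrm (slashA \<iota> k m f (mat2 \<nn> \<beta> 0 \<nn> ** mat2 a b c d) z) \<le> h \<beta>" by metis
  define H where "H = (\<Sum>\<beta> | absA \<beta> < absA \<nn>. nrm (?i \<beta>) * \<bar>h \<beta>\<bar>)"
  have "nrm (slashA \<iota> k (m + s) (char_proj \<iota> k m \<nn> \<xi> e f) \<gamma> z) \<le> nrm (toC (a * d - b * c) ^ s) * H"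
    if z: "z \<in> Omega \<iota>" "1 \<le> im_abs \<iota> z" for z
  proof -
    have "nrm (\<Sum>\<beta> | absA \<beta> < absA \<nn>. ?i \<beta> * slashA \<iota> k m f (mat2 \<nn> \<beta> 0 \<nn> ** mat2 a b c d) z) \<le> H"
    proof (rule nrm_sum_le)
      fix \<beta> assume \<beta>: "\<beta> \<in> {\<beta> :: 'q poly. absA \<beta> < absA \<nn>}"
      have "nrm (?i \<beta> * slashA \<iota> k m f (mat2 \<nn> \<beta> 0 \<nn> ** mat2 a b c d) z) \<le> nrm (?i \<beta>) * \<bar>h \<beta>\<bar>"
        unfolding abs_mult using h[OF z(2), of \<beta>] by (intro mult_left_mono) auto
      also have "\<dots> \<le> H"
        unfolding H_def by (rule member_le_sum[OF \<beta>]) (use card_residues[OF n] in auto)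
      finally show "nrm (?i \<beta> * slashA \<iota> k m f (mat2 \<nn> \<beta> 0 \<nn> ** mat2 a b c d) z) \<le> H" .
    qed (auto simp: H_def intro!: sum_nonneg)
    then show ?thesis
      unfolding \<gamma> slashA_type_add slashA_char_proj[OF z(1) nz] abs_mult
      by (rule mult_left_mono) simp
  qed
  then show ?thesis unfolding bounded_any_center[of _ 0] by (auto simp: dist_commute)
qed

text \<open>Slashing moves the index \<open>\<beta>\<close> to v \<open>\<beta>\<close> with v the
  inverse determinant and so produces \<open>\<chi>(v)\<close>; the additional type contributes
  \<open>\<chi>(\<delta>)\<close>, and these cancel.\<close>

lemma char_proj_Gamma1_invariant:
  assumes root: "root_choice \<iota> \<mm> \<zeta>" and \<psi>: "\<psi> \<in> characters \<iota> \<mm> \<zeta>"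
    and f: "f \<in> mod_forms_char \<iota> k m \<mm> \<psi>"
    and rootn: "root_choice \<iota> \<nn> \<xi>" and e: "e \<in> char_exps \<nn>" and n: "\<nn> \<noteq> 0"
    and \<gamma>: "\<gamma> \<in> Gamma1 (lcm \<mm> (\<nn>\<^sup>2))" and z: "z \<in> Omega \<iota>"
  shows "slashA \<iota> k (m + char_sign \<nn> e) (char_proj \<iota> k m \<nn> \<xi> e f) \<gamma> z = char_proj \<iota> k m \<nn> \<xi> e f z"
proof -
  obtain A B C D where \<gamma>_eq: "\<gamma> = mat2 A B C D" by (rule mat2_cases)
  define \<delta> where "\<delta> = A * D - B * C"
  have \<delta>1: "\<delta> dvd 1" and C: "lcm \<mm> (\<nn>\<^sup>2) dvd C" and D: "lcm \<mm> (\<nn>\<^sup>2) dvd D - 1"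
    using \<gamma> by (auto simp: \<gamma>_eq mat2_in_Gamma1 \<delta>_def)
  then have nz: "A * D - B * C \<noteq> 0" by (auto simp: \<delta>_def)
  obtain v where v: "\<delta> * v = 1" using \<delta>1 by (metis dvdE)
  have "v dvd 1" using v by (metis dvd_triv_right)
  have "\<nn> dvd \<nn>\<^sup>2" by (simp add: power2_eq_square)
  then have nC: "\<nn> dvd C" and nD: "\<nn> dvd D - 1" using C D by (meson dvd_lcm2 dvd_trans)+
  have "\<psi> D = \<psi> 1"
  proof -
    obtain e' where e': "\<psi> = char_of_exps \<iota> \<mm> \<zeta> e'" using \<psi> by (auto simp: characters_def)
    show ?thesis unfolding e'
      by (rule char_of_exps_cong[OF root])
        (use D in \<open>meson dvd_lcm1 dvd_trans in_prime_factors_imp_dvd\<close>)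
  qed
  then have \<psi>D: "\<psi> D = 1" using \<psi> by (auto simp: characters_def)
  let ?i = "char_of_exps \<iota> \<nn> \<xi> (inv_exps e)"
  have "slashA \<iota> k m (char_proj \<iota> k m \<nn> \<xi> e f) \<gamma> z =
      (\<Sum>\<beta> | absA \<beta> < absA \<nn>. ?i \<beta> * slashA \<iota> k m f (mat2 \<nn> (v * \<beta>) 0 \<nn>) z)"
    unfolding \<gamma>_eq slashA_char_proj[OF z nz]
  proof (intro sum.cong refl)
    fix \<beta>
    \<comment> \<open>Modulo \<open>\<nn>\<close> one has D = 1 and C = 0, so the determinant is A
      and v inverts it.\<close>
    have "\<beta> * D - v * \<beta> * A = \<beta> * (D - 1) + \<beta> * (1 - v * A)" by (simp add: algebra_simps)
    also have "1 - v * A = \<delta> * v - v * A" by (simp add: v)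
    also have "\<dots> = v * (A * (D - 1) - B * C)" by (simp add: \<delta>_def algebra_simps)
    finally have "\<nn> dvd \<beta> * D - v * \<beta> * A" using nC nD by simp
    then show "?i \<beta> * slashA \<iota> k m f (mat2 \<nn> \<beta> 0 \<nn> ** mat2 A B C D) z =
        ?i \<beta> * slashA \<iota> k m f (mat2 \<nn> (v * \<beta>) 0 \<nn>) z"
      using slashA_translation_Gamma0[OF root \<psi> f n \<delta>1[unfolded \<delta>_def] C _ z] \<psi>D by simp
  qed
  also have "\<dots> = char_of_exps \<iota> \<nn> \<xi> e v * char_proj \<iota> k m \<nn> \<xi> e f z"
    unfolding char_proj_def
    by (rule char_proj_reindex[OF rootn e n])
      (use \<open>v dvd 1\<close> slashA_translation_cong[OF root \<psi> f n _ z] in \<open>auto intro: is_unit_left_imp_coprime\<close>)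
  finally have "slashA \<iota> k (m + char_sign \<nn> e) (char_proj \<iota> k m \<nn> \<xi> e f) \<gamma> z =
      char_of_exps \<iota> \<nn> \<xi> e \<delta> * char_of_exps \<iota> \<nn> \<xi> e v * char_proj \<iota> k m \<nn> \<xi> e f z"
    unfolding \<gamma>_eq slashA_type_add \<delta>_def[symmetric] char_of_exps_unit[OF \<delta>1] by simp
  then show ?thesis by (simp add: v flip: char_of_exps_mult)
qed

text \<open>The triangular Hecke matrices satisfy \<open>[\<alpha>] M = M [\<qq> \<alpha>]\<close>
  exactly. The last one does so only up to \<open>Gamma0\<close>, and there its two versions, for
  the levels \<open>\<aa>\<close> and \<open>\<mm>\<close>, are compared through the common factor
  \<open>\<psi>(\<qq>)\<close>.\<close>

lemma hecke_char_proj: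
  assumes root: "root_choice \<iota> \<mm> \<zeta>" and \<psi>: "\<psi> \<in> characters \<iota> \<mm> \<zeta>"
    and f: "f \<in> mod_forms_char \<iota> k m \<mm> \<psi>"
    and rootn: "root_choice \<iota> \<nn> \<xi>" and e: "e \<in> char_exps \<nn>" and n: "\<nn> \<noteq> 0"
    and q: "\<qq> \<noteq> 0" "coprime \<qq> \<nn>"
    and \<mu>: "\<mu> * \<qq> - \<nu> * \<mm> = 1" and \<mu>': "\<mu>' * \<qq> - \<nu>' * lcm \<mm> (\<nn>\<^sup>2) = 1"
    and eigen: "\<And>z. z \<in> Omega \<iota> \<Longrightarrow> hecke \<iota> k m \<mm> \<qq> \<mu> \<nu> f z = ev * f z" and z: "z \<in> Omega \<iota>"
  shows "hecke \<iota> k (m + s) (lcm \<mm> (\<nn>\<^sup>2)) \<qq> \<mu>' \<nu>' (char_proj \<iota> k m \<nn> \<xi> e f) z =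
    char_of_exps \<iota> \<nn> \<xi> e \<qq> * ev * char_proj \<iota> k m \<nn> \<xi> e f z"
proof -
  define \<aa> where "\<aa> = lcm \<mm> (\<nn>\<^sup>2)"
  define g where "g = char_proj \<iota> k m \<nn> \<xi> e f"
  let ?i = "char_of_exps \<iota> \<nn> \<xi> (inv_exps e)"
  let ?S = "{\<beta>. absA \<beta> < absA \<nn>}" and ?Q = "{\<beta>. absA \<beta> < absA \<qq>}"
  let ?c = "toC \<qq> powi (int k - int m)"
  have detq: "(\<mu> * \<qq>) * \<qq> - \<nu> * (\<mm> * \<qq>) = \<qq>" "(\<mu>' * \<qq>) * \<qq> - \<nu>' * (\<aa> * \<qq>) = \<qq>"
  proof -
    have "(\<mu> * \<qq>) * \<qq> - \<nu> * (\<mm> * \<qq>) = (\<mu> * \<qq> - \<nu> * \<mm>) * \<qq>"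
      "(\<mu>' * \<qq>) * \<qq> - \<nu>' * (\<aa> * \<qq>) = (\<mu>' * \<qq> - \<nu>' * \<aa>) * \<qq>" by (simp_all add: algebra_simps)
    then show "(\<mu> * \<qq>) * \<qq> - \<nu> * (\<mm> * \<qq>) = \<qq>" "(\<mu>' * \<qq>) * \<qq> - \<nu>' * (\<aa> * \<qq>) = \<qq>"
      using \<mu> \<mu>' by (simp_all add: \<aa>_def)
  qed
  \<comment> \<open>All Hecke matrices have determinant \<open>\<qq>\<close>, so raising the type by
    \<open>s\<close> multiplies the slashes by \<open>\<qq> ^ s\<close>, which the normalising power
    removes.\<close>
  have type: "toC \<qq> powi (int k - int (m + s)) * toC \<qq> ^ s = ?c"
    using q by (simp add: power_int_diff power_int_add field_simps)
  have "hecke \<iota> k (m + s) \<aa> \<qq> \<mu>' \<nu>' g z =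
      ?c * ((\<Sum>\<beta>\<in>?Q. slashA \<iota> k m g (mat2 1 \<beta> 0 \<qq>) z) + slashA \<iota> k m g (mat2 (\<mu>' * \<qq>) \<nu>' (\<aa> * \<qq>) \<qq>) z)"
    unfolding hecke_def slashA_type_add detq type[symmetric]
    by (simp add: sum_distrib_left distrib_left mult_ac)
  also have "(\<Sum>\<beta>\<in>?Q. slashA \<iota> k m g (mat2 1 \<beta> 0 \<qq>) z) =
      (\<Sum>\<alpha>\<in>?S. ?i \<alpha> * (\<Sum>\<beta>\<in>?Q. slashA \<iota> k m f (mat2 1 \<beta> 0 \<qq> ** mat2 \<nn> (\<qq> * \<alpha>) 0 \<nn>) z))"
  proof -
    have "slashA \<iota> k m g (mat2 1 \<beta> 0 \<qq>) z =
        (\<Sum>\<alpha>\<in>?S. ?i \<alpha> * slashA \<iota> k m f (mat2 1 \<beta> 0 \<qq> ** mat2 \<nn> (\<qq> * \<alpha>) 0 \<nn>) z)" for \<beta>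
      unfolding g_def using q
      by (subst slashA_char_proj[OF z]) (simp_all add: mat2_mult algebra_simps)
    then show ?thesis by (simp add: sum_distrib_left sum.swap[of _ ?Q])
  qed
  also have "slashA \<iota> k m g (mat2 (\<mu>' * \<qq>) \<nu>' (\<aa> * \<qq>) \<qq>) z =
      (\<Sum>\<alpha>\<in>?S. ?i \<alpha> * slashA \<iota> k m f (mat2 (\<mu> * \<qq>) \<nu> (\<mm> * \<qq>) \<qq> ** mat2 \<nn> (\<qq> * \<alpha>) 0 \<nn>) z)"
  proof -
    have "slashA \<iota> k m f (mat2 \<nn> \<alpha> 0 \<nn> ** mat2 (\<mu>' * \<qq>) \<nu>' (\<aa> * \<qq>) \<qq>) z =
        slashA \<iota> k m f (mat2 (\<mu> * \<qq>) \<nu> (\<mm> * \<qq>) \<qq> ** mat2 \<nn> (\<qq> * \<alpha>) 0 \<nn>) z" for \<alpha>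
    proof -
      \<comment> \<open>The last Hecke matrix is a matrix of determinant 1 in
        \<open>Gamma0 \<aa>\<close> with lower right entry \<open>\<qq>\<close>, times
        diag(\<open>\<qq>\<close>, 1).\<close>
      have "slashA \<iota> k m f (mat2 \<nn> \<alpha> 0 \<nn> ** mat2 (\<mu>' * \<qq>) \<nu>' (\<aa> * \<qq>) \<qq>) z =
          slashA \<iota> k m f ((mat2 \<nn> \<alpha> 0 \<nn> ** mat2 \<mu>' \<nu>' \<aa> \<qq>) ** mat2 \<qq> 0 0 1) z"
        by (simp add: mat2_mult algebra_simps)
      also have "\<dots> = slashA \<iota> k m (slashA \<iota> k m f (mat2 \<nn> \<alpha> 0 \<nn> ** mat2 \<mu>' \<nu>' \<aa> \<qq>)) (mat2 \<qq> 0 0 1) z"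
        unfolding mat2_mult[of \<nn>] by (rule slashA_mult) simp
      also have "\<dots> = \<psi> \<qq> * slashA \<iota> k m (slashA \<iota> k m f (mat2 \<nn> (\<alpha> * \<qq> * \<qq>) 0 \<nn>)) (mat2 \<qq> 0 0 1) z"
      proof (rule slashA_cmult_cong[OF _ z])
        fix w assume w: "w \<in> Omega \<iota>"
        \<comment> \<open>Modulo \<open>\<nn>\<close> the entry \<open>\<mu>'\<close> inverts
          \<open>\<qq>\<close>, which forces the new index
          \<open>\<alpha> * \<qq> * \<qq>\<close>.\<close>
        have "\<alpha> * \<qq> - \<alpha> * \<qq> * \<qq> * \<mu>' = - \<alpha> * \<qq> * (\<mu>' * \<qq> - 1)" by (simp add: algebra_simps)
        also have "\<mu>' * \<qq> - 1 = \<nu>' * \<aa>" using \<mu>' by (simp add: \<aa>_def algebra_simps)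
        also have "\<nn> dvd - \<alpha> * \<qq> * (\<nu>' * \<aa>)"
          unfolding \<aa>_def power2_eq_square by (meson dvd_lcm2 dvd_mult dvd_mult_left)
        finally show "slashA \<iota> k m f (mat2 \<nn> \<alpha> 0 \<nn> ** mat2 \<mu>' \<nu>' \<aa> \<qq>) w =
            \<psi> \<qq> * slashA \<iota> k m f (mat2 \<nn> (\<alpha> * \<qq> * \<qq>) 0 \<nn>) w"
          by (intro slashA_translation_Gamma0[OF root \<psi> f n _ _ _ w]) (use \<mu>' in \<open>auto simp: \<aa>_def\<close>)
      qed (use q in simp)
      also have "slashA \<iota> k m (slashA \<iota> k m f (mat2 \<nn> (\<alpha> * \<qq> * \<qq>) 0 \<nn>)) (mat2 \<qq> 0 0 1) z =
          slashA \<iota> k m f (mat2 (\<qq> * \<nn>) (\<qq> * \<qq> * \<alpha>) 0 \<nn>) z"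
        by (subst slashA_mult[symmetric]) (simp_all add: mat2_mult algebra_simps)
      \<comment> \<open>The factor \<open>\<psi> \<qq>\<close> is absorbed by the matrix of level
        \<open>\<mm>\<close>, whose lower right entry is \<open>\<qq>\<close> as well.\<close>
      also have "\<psi> \<qq> * \<dots> = slashA \<iota> k m (slashA \<iota> k m f (mat2 \<mu> \<nu> \<mm> \<qq>)) (mat2 (\<qq> * \<nn>) (\<qq> * \<qq> * \<alpha>) 0 \<nn>) z"
      proof (rule slashA_cmult_cong[OF _ z, symmetric])
        have "mat2 \<mu> \<nu> \<mm> \<qq> \<in> Gamma0 \<mm>" using \<mu> by (simp add: mat2_in_Gamma0)
        then show "slashA \<iota> k m f (mat2 \<mu> \<nu> \<mm> \<qq>) w = \<psi> \<qq> * f w" if "w \<in> Omega \<iota>" for w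
          using f that by (auto simp: mod_forms_char_def)
      qed (use n q in simp)
      also have "\<dots> = slashA \<iota> k m f (mat2 \<mu> \<nu> \<mm> \<qq> ** mat2 (\<qq> * \<nn>) (\<qq> * \<qq> * \<alpha>) 0 \<nn>) z"
        using n by (intro slashA_mult[symmetric]) simp
      also have "\<dots> = slashA \<iota> k m f (mat2 (\<mu> * \<qq>) \<nu> (\<mm> * \<qq>) \<qq> ** mat2 \<nn> (\<qq> * \<alpha>) 0 \<nn>) z"
        by (simp add: mat2_mult algebra_simps)
      finally show ?thesis .
    qed
    then show ?thesis
      unfolding g_def using q detq by (subst slashA_char_proj[OF z]) simp_all
  qed
  \<comment> \<open>Collected over all Hecke matrices, the terms form \<open>T\<^sub>\<qq> f\<close>
    slashed with \<open>[\<qq> \<alpha>]\<close>, to which the eigenvalue equation applies.\<close>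
  also have "?c * ((\<Sum>\<alpha>\<in>?S. ?i \<alpha> * (\<Sum>\<beta>\<in>?Q. slashA \<iota> k m f (mat2 1 \<beta> 0 \<qq> ** mat2 \<nn> (\<qq> * \<alpha>) 0 \<nn>) z)) +
      (\<Sum>\<alpha>\<in>?S. ?i \<alpha> * slashA \<iota> k m f (mat2 (\<mu> * \<qq>) \<nu> (\<mm> * \<qq>) \<qq> ** mat2 \<nn> (\<qq> * \<alpha>) 0 \<nn>) z)) =
      (\<Sum>\<alpha>\<in>?S. ?i \<alpha> * slashA \<iota> k m (hecke \<iota> k m \<mm> \<qq> \<mu> \<nu> f) (mat2 \<nn> (\<qq> * \<alpha>) 0 \<nn>) z)"
  proof -
    have "slashA \<iota> k m (hecke \<iota> k m \<mm> \<qq> \<mu> \<nu> f) (mat2 \<nn> x 0 \<nn>) z =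
      ?c * ((\<Sum>\<beta>\<in>?Q. slashA \<iota> k m f (mat2 1 \<beta> 0 \<qq> ** mat2 \<nn> x 0 \<nn>) z) +
        slashA \<iota> k m f (mat2 (\<mu> * \<qq>) \<nu> (\<mm> * \<qq>) \<qq> ** mat2 \<nn> x 0 \<nn>) z)" for x
    proof -
      have j: "toC 0 * z + toC \<nn> \<noteq> 0" using n by simp
      show ?thesis
        unfolding slashA_mult[OF j] unfolding slashA_mat2[of _ _ _ \<nn>] hecke_def
        by (simp add: sum_distrib_left distrib_left mult_ac)
    qed
    then show ?thesis
      by (simp add: distrib_left sum_distrib_left sum.distrib mult.left_commute)
  qed
  also have "\<dots> = (\<Sum>\<alpha>\<in>?S. ?i \<alpha> * (ev * slashA \<iota> k m f (mat2 \<nn> (\<qq> * \<alpha>) 0 \<nn>) z))"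
    using n by (intro sum.cong refl arg_cong[of _ _ "\<lambda>x. _ * x"] slashA_cmult_cong[OF eigen z]) auto
  also have "\<dots> = char_of_exps \<iota> \<nn> \<xi> e \<qq> * (\<Sum>\<alpha>\<in>?S. ?i \<alpha> * (ev * slashA \<iota> k m f (mat2 \<nn> \<alpha> 0 \<nn>) z))"
    by (rule char_proj_reindex[OF rootn e n q(2)]) (use slashA_translation_cong[OF root \<psi> f n _ z] in auto)
  also have "\<dots> = char_of_exps \<iota> \<nn> \<xi> e \<qq> * ev * g z"
    by (simp add: g_def char_proj_def sum_distrib_left mult_ac)
  finally show ?thesis by (simp only: \<aa>_def g_def)
qed

end

theorem theorem2p8:
  fixes \<iota> :: "'q::{finite_field,field_gcd} fls alg_closure \<Rightarrow> 'c::{field,complete_space}"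
    and \<mm> \<nn> \<qq> \<aa> :: "'q poly"
    and \<zeta> \<xi> :: "'q poly \<Rightarrow> 'c"
    and \<psi> chi :: "'q poly \<Rightarrow> 'c"
    and e :: "'q poly \<Rightarrow> nat"
    and k m s :: nat
    and f g :: "'c \<Rightarrow> 'c"
  assumes "C_infinity \<iota>"
    and "Polynomial.lead_coeff \<mm> = 1" and "Polynomial.lead_coeff \<nn> = 1"
    and "root_choice \<iota> \<mm> \<zeta>" and "root_choice \<iota> \<nn> \<xi>"
    and "\<psi> \<in> characters \<iota> \<mm> \<zeta>"
    and "f \<in> mod_forms_char \<iota> k m \<mm> \<psi>"
    and "e \<in> char_exps \<nn>" and "chi = char_of_exps \<iota> \<nn> \<xi> e" and "s = char_sign \<nn> e"
    and "Polynomial.lead_coeff \<qq> = 1" and "Factorial_Ring.irreducible \<qq>" and "gcd \<qq> (\<nn> * \<mm>) = 1"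
    and "\<aa> = lcm \<mm> (\<nn>\<^sup>2)"
    and "g = char_proj \<iota> k m \<nn> \<xi> e f"
  shows "g \<in> mod_forms \<iota> k (m + s) (Gamma1 \<aa>) \<and>
    (\<forall>\<mu> \<nu> \<mu>' \<nu>' :: 'q poly. \<forall>ev :: 'c.
       \<mu> * \<qq> - \<nu> * \<mm> = 1 \<longrightarrow> \<mu>' * \<qq> - \<nu>' * \<aa> = 1 \<longrightarrow>
       (\<forall>z\<in>Omega \<iota>. hecke \<iota> k m \<mm> \<qq> \<mu> \<nu> f z = ev * f z) \<longrightarrow>
       (\<forall>z\<in>Omega \<iota>. hecke \<iota> k (m + s) \<aa> \<qq> \<mu>' \<nu>' g z = chi \<qq> * ev * g z))"
proof -
  interpret C_infinity \<iota> by fact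
  have nz: "\<mm> \<noteq> 0" "\<nn> \<noteq> 0" "\<qq> \<noteq> 0" using assms(2,3,11) by auto
  have "coprime \<qq> (\<nn> * \<mm>)" using assms(13) by (rule gcd_eq_1_imp_coprime)
  then have cop: "coprime \<qq> \<nn>" by simp
  have f: "f \<in> mod_forms \<iota> k m (Gamma1 \<mm>)" using assms(7) by (simp add: mod_forms_char_def)
  then have "rigid_analytic \<iota> f" by (simp add: mod_forms_def)
  then have "g \<in> mod_forms \<iota> k (m + s) (Gamma1 \<aa>)"
    using char_proj_rigid_analytic char_proj_bounded[OF f nz(1,2)]
      char_proj_Gamma1_invariant[OF assms(4,6,7,5,8) nz(2)] nz(2)
    unfolding mod_forms_def assms(10,14,15) by blast
  moreover have "hecke \<iota> k (m + s) \<aa> \<qq> \<mu>' \<nu>' g z = chi \<qq> * ev * g z"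
    if "\<mu> * \<qq> - \<nu> * \<mm> = 1" "\<mu>' * \<qq> - \<nu>' * \<aa> = 1"
      "\<forall>z\<in>Omega \<iota>. hecke \<iota> k m \<mm> \<qq> \<mu> \<nu> f z = ev * f z" "z \<in> Omega \<iota>" for \<mu> \<nu> \<mu>' \<nu>' ev z
    using hecke_char_proj[OF assms(4,6,7,5,8) nz(2,3) cop that(1), of \<mu>' \<nu>' ev z s] that
    unfolding assms(9,14,15) by blast
  ultimately show ?thesis by blast
qed

end
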